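(* Let $\mathbb{M},\mathbb{W}$ be two vertical subgroups of $\mathbb{H}^n$ and $\mathbb{V}\subset\mathbb{H}^n$ a $k$-dimensional horizontal subgroup such that $\mathbb{H}^n=\mathbb{M}\rtimes\mathbb{V}=\mathbb{W}\rtimes\mathbb{V}$. Let $$V=v_1\wedge\cdots\wedge v_k,\quad N=w_1\wedge\cdots\wedge w_{2n-k}\wedge e_{2n+1},\quad M=m_1\wedge\cdots\wedge m_{2n-k}\wedge e_{2n+1},$$ where $(v_1,\dots,v_k)$, $(w_1,\dots,w_{2n-k},e_{2n+1})$, $(m_1,\dots,m_{2n-k},e_{2n+1})$ are orthonormal bases of $\mathbb{V}$, $\mathbb{W}$, $\mathbb{M}$, respectively. Then for every Borel set $B\subset\mathbb{M}$ $$(\pi^{\mathbb{M},\mathbb{V}}_{\mathbb{M},\mathbb{W}})_\sharp\mathcal{H}^{2n+1-k}_E(B)=\mathcal{H}^{2n+1-k}_E\big(\pi^{\mathbb{W},\mathbb{V}}_{\mathbb{W},\mathbb{M}}(B)\big)=\frac{\|V\wedge M\|_g}{\|V\wedge N\|_g}\,\mathcal{H}^{2n+1-k}_E(B).$$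
   Context: Heisenberg group: $\mathbb{H}^n=H_1\oplus H_2$ is a real vector space, $\dim H_1=2n$, $\dim H_2=1$, with a symplectic form $\omega$ on $H_1$ and a fixed $0\ne e_{2n+1}\in H_2$; $\pi_{H_1}$ is the projection on $H_1$, $[p,q]=\omega(\pi_{H_1}p,\pi_{H_1}q)e_{2n+1}$ and $pq=p+q+\frac12[p,q]$ (identity $0$). Dilations: $\delta_t$ is linear with $\delta_t w=t^iw$ for $w\in H_i$, $t>0$. Fix a basis $(e_1,\dots,e_{2n})$ of $H_1$ with $\omega(e_i,e_{n+j})=\delta_{ij}$, $\omega(e_i,e_j)=\omega(e_{n+i},e_{n+j})=0$ for $1\le i,j\le n$, and the scalar product making $(e_1,\dots,e_{2n+1})$ orthonormal. $\|\cdot\|_g$ on $\Lambda_{2n+1}(\mathbb{H}^n)$ is the norm induced by this scalar product. $\mathcal{H}^p_E$ is the $p$-dimensional Hausdorff measure for the Euclidean distance (normalized to agree with Lebesgue measure on $p$-dimensional subspaces). Homogeneous subgroups are Lie subgroups closed under all $\delta_t$ (they are linear subspaces); vertical ones contain $H_2$, horizontal ones are contained in $H_1$. $\mathbb{H}^n=\mathbb{W}\rtimes\mathbb{V}$ means $\mathbb{W}$ vertical, $\mathbb{V}$ horizontal, $\mathbb{H}^n=\mathbb{W}\mathbb{V}$ (group product), $\mathbb{W}\cap\mathbb{V}=\{0\}$; then each $x$ is uniquely $x=\pi^{\mathbb{W},\mathbb{V}}_{\mathbb{W}}(x)\,\pi^{\mathbb{W},\mathbb{V}}_{\mathbb{V}}(x)$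 with factors in $\mathbb{W}$ and $\mathbb{V}$; similarly for $\mathbb{M}\rtimes\mathbb{V}$. Define $\pi^{\mathbb{W},\mathbb{V}}_{\mathbb{W},\mathbb{M}}=\pi^{\mathbb{W},\mathbb{V}}_{\mathbb{W}}|_{\mathbb{M}}:\mathbb{M}\to\mathbb{W}$ and $\pi^{\mathbb{M},\mathbb{V}}_{\mathbb{M},\mathbb{W}}=\pi^{\mathbb{M},\mathbb{V}}_{\mathbb{M}}|_{\mathbb{W}}:\mathbb{W}\to\mathbb{M}$; these are mutually inverse bijections. The push-forward in the claim is of $\mathcal{H}^{2n+1-k}_E$ on $\mathbb{W}$. *)

theory Defs
  imports "HOL-Analysis.Analysis" "HOL-Algebra.Coset"
begin

section \<open>The Heisenberg group\<close>

text \<open>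
  The underlying real vector space is an arbitrary finite-dimensional real inner product space.
  The inner product plays no role in the group structure; it is tied to a symplectic basis
  by \<open>heisenberg_basis\<close> below.  The field \<open>vert\<close> is the fixed nonzero vector of the second layer.
\<close>

record 'a heis =
  layer1 :: "'a set"
  layer2 :: "'a set"
  symp :: "'a \<Rightarrow> 'a \<Rightarrow> real"
  vert :: "'a"

definition symplectic_on :: "'a::real_vector set \<Rightarrow> ('a \<Rightarrow> 'a \<Rightarrow> real) \<Rightarrow> bool" where
  "symplectic_on S \<omega> \<longleftrightarrow>
     (\<forall>x\<in>S. \<forall>y\<in>S. \<forall>z\<in>S. \<forall>a b.
        \<omega> (a *\<^sub>R x + b *\<^sub>R y) z = a * \<omega> x z + b * \<omega> y z \<and>
        \<omega> z (a *\<^sub>R x + b *\<^sub>R y) = a * \<omega> z x + b * \<omega> z y) \<and>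
     (\<forall>x\<in>S. \<omega> x x = 0) \<and>
     (\<forall>x\<in>S. (\<forall>y\<in>S. \<omega> x y = 0) \<longrightarrow> x = 0)"

definition heisenberg :: "nat \<Rightarrow> 'a::euclidean_space heis \<Rightarrow> bool" where
  "heisenberg n H \<longleftrightarrow>
     n \<ge> 1 \<and>
     subspace (layer1 H) \<and> subspace (layer2 H) \<and>
     dim (layer1 H) = 2 * n \<and> dim (layer2 H) = 1 \<and>
     layer1 H \<inter> layer2 H = {0} \<and>
     {u + w | u w. u \<in> layer1 H \<and> w \<in> layer2 H} = UNIV \<and>
     symplectic_on (layer1 H) (symp H) \<and>
     vert H \<in> layer2 H \<and> vert H \<noteq> 0"

definition proj1 :: "'a::euclidean_space heis \<Rightarrow> 'a \<Rightarrow> 'a" where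
  "proj1 H x = (THE u. u \<in> layer1 H \<and> x - u \<in> layer2 H)"

definition hbracket :: "'a::euclidean_space heis \<Rightarrow> 'a \<Rightarrow> 'a \<Rightarrow> 'a" where
  "hbracket H p q = symp H (proj1 H p) (proj1 H q) *\<^sub>R vert H"

definition hgroup :: "'a::euclidean_space heis \<Rightarrow> 'a monoid" where
  "hgroup H = \<lparr>carrier = UNIV, mult = (\<lambda>p q. p + q + (1/2) *\<^sub>R hbracket H p q), one = 0\<rparr>"

definition dilation :: "'a::euclidean_space heis \<Rightarrow> real \<Rightarrow> 'a \<Rightarrow> 'a" where
  "dilation H t x = t *\<^sub>R proj1 H x + t\<^sup>2 *\<^sub>R (x - proj1 H x)"

text \<open>
  A basis adapted to the symplectic form which is orthonormal for the inner product of \<open>'a\<close>;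
  thus the inner product is the one making \<open>e 1, \<dots>, e (2 * n + 1)\<close> orthonormal.
\<close>

definition heisenberg_basis :: "nat \<Rightarrow> 'a::euclidean_space heis \<Rightarrow> (nat \<Rightarrow> 'a) \<Rightarrow> bool" where
  "heisenberg_basis n H e \<longleftrightarrow>
     (\<forall>i\<in>{1..2 * n}. e i \<in> layer1 H) \<and> span (e ` {1..2 * n}) = layer1 H \<and>
     e (2 * n + 1) = vert H \<and>
     (\<forall>i\<in>{1..n}. \<forall>j\<in>{1..n}.
        symp H (e i) (e (n + j)) = of_bool (i = j) \<and>
        symp H (e i) (e j) = 0 \<and> symp H (e (n + i)) (e (n + j)) = 0) \<and>
     (\<forall>i\<in>{1..2 * n + 1}. \<forall>j\<in>{1..2 * n + 1}. e i \<bullet> e j = of_bool (i = j))"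


section \<open>Homogeneous subgroups and semidirect products\<close>

text \<open>
  Lie subgroups are taken to be topologically closed subgroups (Cartan's theorem).  Nothing depends
  on this choice: a subgroup that is closed under all dilations and that contains the second layer
  or is contained in the first one is a linear subspace
  (\<open>vertical_subspace\<close> and \<open>horizontal_subspace\<close> below).
\<close>

definition homogeneous_subgroup :: "'a::euclidean_space heis \<Rightarrow> 'a set \<Rightarrow> bool" where
  "homogeneous_subgroup H S \<longleftrightarrow>
     subgroup S (hgroup H) \<and> closed S \<and> (\<forall>t>0. \<forall>x\<in>S. dilation H t x \<in> S)"

definition vertical_subgroup :: "'a::euclidean_space heis \<Rightarrow> 'a set \<Rightarrow> bool" where
  "vertical_subgroup H W \<longleftrightarrow> homogeneous_subgroup H W \<and> layer2 H \<subseteq> W"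

definition horizontal_subgroup :: "'a::euclidean_space heis \<Rightarrow> 'a set \<Rightarrow> bool" where
  "horizontal_subgroup H V \<longleftrightarrow> homogeneous_subgroup H V \<and> V \<subseteq> layer1 H"

definition semidirect :: "'a::euclidean_space heis \<Rightarrow> 'a set \<Rightarrow> 'a set \<Rightarrow> bool" where
  "semidirect H W V \<longleftrightarrow>
     vertical_subgroup H W \<and> horizontal_subgroup H V \<and>
     W <#>\<^bsub>hgroup H\<^esub> V = UNIV \<and> W \<inter> V = {0}"

definition vproj :: "'a::euclidean_space heis \<Rightarrow> 'a set \<Rightarrow> 'a set \<Rightarrow> 'a \<Rightarrow> 'a" where
  "vproj H W V x = (THE w. w \<in> W \<and> (\<exists>v\<in>V. x = w \<otimes>\<^bsub>hgroup H\<^esub> v))"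

lemma heisenbergD:
  assumes "heisenberg n H"
  shows "subspace (layer1 H)" "subspace (layer2 H)" "layer1 H \<inter> layer2 H = {0}"
    "{u + w | u w. u \<in> layer1 H \<and> w \<in> layer2 H} = UNIV"
    "symplectic_on (layer1 H) (symp H)" "vert H \<in> layer2 H"
  using assms unfolding heisenberg_def by - (elim conjE, assumption)+

lemma proj1_eqI:
  assumes H: "heisenberg n H" and u: "u \<in> layer1 H" and w: "w \<in> layer2 H"
  shows "proj1 H (u + w) = u"
  unfolding proj1_def
proof (rule the_equality)
  show "u \<in> layer1 H \<and> u + w - u \<in> layer2 H"
    using u w by simp
next
  fix u' assume u': "u' \<in> layer1 H \<and> u + w - u' \<in> layer2 H"
  have "u' - u \<in> layer1 H"
    using subspace_diff[OF heisenbergD(1)[OF H] conjunct1[OF u'] u] .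
  moreover have "u' - u \<in> layer2 H"
    using subspace_diff[OF heisenbergD(2)[OF H] w conjunct2[OF u']] by simp
  ultimately have "u' - u \<in> {0}"
    unfolding heisenbergD(3)[OF H, symmetric] by (rule IntI)
  thus "u' = u"
    by simp
qed

lemma proj1_props:
  assumes "heisenberg n H"
  shows "proj1 H x \<in> layer1 H" "x - proj1 H x \<in> layer2 H"
proof -
  have "x \<in> {u + w | u w. u \<in> layer1 H \<and> w \<in> layer2 H}"
    by (simp only: heisenbergD[OF assms] UNIV_I)
  then obtain u w where x: "x = u + w" and uw: "u \<in> layer1 H" "w \<in> layer2 H"
    by blast
  have "proj1 H x = u"
    using proj1_eqI[OF assms uw] x by simp
  thus "proj1 H x \<in> layer1 H" "x - proj1 H x \<in> layer2 H"
    using uw x by simp_all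
qed

lemma proj1_linear:
  assumes "heisenberg n H"
  shows "proj1 H (x + y) = proj1 H x + proj1 H y"
    and "proj1 H (c *\<^sub>R x) = c *\<^sub>R proj1 H x"
proof -
  have s: "subspace (layer1 H)" "subspace (layer2 H)"
    by (fact heisenbergD[OF assms(1)])+
  note p = proj1_props[OF assms]
  show "proj1 H (x + y) = proj1 H x + proj1 H y"
    using proj1_eqI[OF assms subspace_add[OF s(1) p(1)[of x] p(1)[of y]]
        subspace_add[OF s(2) p(2)[of x] p(2)[of y]]]
    by (simp add: algebra_simps)
  show "proj1 H (c *\<^sub>R x) = c *\<^sub>R proj1 H x"
    using proj1_eqI[OF assms subspace_scale[OF s(1) p(1)[of x], of c]
        subspace_scale[OF s(2) p(2)[of x], of c]]
    by (simp add: algebra_simps)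
qed

lemma proj1_layer1:
  assumes "heisenberg n H" "x \<in> layer1 H"
  shows "proj1 H x = x"
  using proj1_eqI[OF assms(1,2), of 0] subspace_0[OF heisenbergD(1)[OF assms(1)]] subspace_0[OF heisenbergD(2)[OF assms(1)]] by simp

lemma proj1_layer2:
  assumes "heisenberg n H" "x \<in> layer2 H"
  shows "proj1 H x = 0"
  using proj1_eqI[OF assms(1) _ assms(2), of 0] subspace_0[OF heisenbergD(1)[OF assms(1)]] subspace_0[OF heisenbergD(2)[OF assms(1)]] by simp

lemma symp_simps:
  assumes "heisenberg n H" "x \<in> layer1 H"
  shows "symp H x x = 0" "symp H x (c *\<^sub>R x) = 0" "symp H (c *\<^sub>R x) x = 0"
    "symp H x 0 = 0" "symp H 0 x = 0"
proof -
  have sy: "symplectic_on (layer1 H) (symp H)"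
    by (fact heisenbergD[OF assms(1)])
  note bil = conjunct1[OF sy[unfolded symplectic_on_def], rule_format, OF assms(2,2,2)]
  show 0: "symp H x x = 0"
    using sy assms(2) by (simp only: symplectic_on_def)
  show c: "symp H x (c *\<^sub>R x) = 0" "symp H (c *\<^sub>R x) x = 0" for c
    using bil[of c 0] by (simp_all only: 0 mult_zero_right add_0_right scaleR_zero_left simp_thms)
  show "symp H x 0 = 0" "symp H 0 x = 0"
    using c[of 0] by (simp_all only: scaleR_zero_left)
qed

lemma mult_hgroup:
  "x \<otimes>\<^bsub>hgroup H\<^esub> y = x + y + (1/2) *\<^sub>R hbracket H x y"
  by (simp add: hgroup_def)

lemma hbracket_layer2:
  assumes "heisenberg n H"
  shows "hbracket H x y \<in> layer2 H"
  using heisenbergD[OF assms] by (simp only: hbracket_def subspace_scale)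

lemma inv_hgroup:
  assumes H: "heisenberg n H"
  shows "inv\<^bsub>hgroup H\<^esub> x = - x"
proof -
  have neg: "proj1 H (- x) = (-1) *\<^sub>R proj1 H x" for x
    using proj1_linear(2)[OF H, of "-1" x] by simp
  have 0: "hbracket H x (- x) = 0" "hbracket H (- x) x = 0" for x
    using symp_simps(2,3)[OF H proj1_props(1)[OF H, of x], of "-1"]
    unfolding hbracket_def neg by simp_all
  have "y = - x" if "x + y + (1/2) *\<^sub>R hbracket H x y = 0" for y
  proof -
    have "proj1 H (x + y + (1/2) *\<^sub>R hbracket H x y) = proj1 H x + proj1 H y"
      by (simp add: proj1_linear[OF H] proj1_layer2[OF H] hbracket_layer2[OF H])
    hence "proj1 H y = (-1) *\<^sub>R proj1 H x"
      using that proj1_linear(2)[OF H, of 0 0] by (simp add: add_eq_0_iff)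
    hence "hbracket H x y = 0"
      using symp_simps(2)[OF H proj1_props(1)[OF H, of x], of "-1"]
      by (simp add: hbracket_def)
    thus ?thesis
      using that by (simp add: add_eq_0_iff)
  qed
  hence uniq: "y = - x" if "x \<otimes>\<^bsub>hgroup H\<^esub> y = 0" for y
    using that by (simp only: mult_hgroup)
  have c: "carrier (hgroup H) = UNIV" "\<one>\<^bsub>hgroup H\<^esub> = 0"
    by (simp_all add: hgroup_def)
  have "x \<otimes>\<^bsub>hgroup H\<^esub> (- x) = 0" "(- x) \<otimes>\<^bsub>hgroup H\<^esub> x = 0"
    by (simp_all add: mult_hgroup 0)
  thus ?thesis
    unfolding m_inv_def c using uniq by (intro the_equality) blast+
qed

lemma vertical_subspace:
  assumes H: "heisenberg n H" and W: "vertical_subgroup H W"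
  shows "subspace W"
proof -
  have sg: "subgroup W (hgroup H)" and L2: "layer2 H \<subseteq> W"
    and dil: "\<And>t x. t > 0 \<Longrightarrow> x \<in> W \<Longrightarrow> dilation H t x \<in> W"
    using W by (auto simp: vertical_subgroup_def homogeneous_subgroup_def)
  have s2: "subspace (layer2 H)"
    by (fact heisenbergD[OF H])+
  have zero: "0 \<in> W"
    using subgroup.one_closed[OF sg] by (simp add: hgroup_def)
  have add2: "x + c \<in> W" if "x \<in> W" "c \<in> layer2 H" for x c
  proof -
    have "hbracket H x c = 0"
      using symp_simps(4)[OF H proj1_props(1)[OF H, of x]]
      by (simp add: hbracket_def proj1_layer2[OF H that(2)])
    thus ?thesis
      using subgroup.m_closed[OF sg that(1), of c] L2 that(2) by (auto simp: mult_hgroup)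
  qed
  have add: "x + y \<in> W" if "x \<in> W" "y \<in> W" for x y
    using add2[OF subgroup.m_closed[OF sg that],
        OF subspace_scale[OF s2 hbracket_layer2[OF H], of "-(1/2)" x y]]
    by (simp add: mult_hgroup)
  have pos: "t *\<^sub>R x \<in> W" if "t > 0" "x \<in> W" for t x
    using add2[OF dil[OF that] subspace_scale[OF s2 proj1_props(2)[OF H, of x], of "t - t\<^sup>2"]]
    by (simp add: dilation_def algebra_simps)
  have neg: "- x \<in> W" if "x \<in> W" for x
    using subgroup.m_inv_closed[OF sg that] by (simp add: inv_hgroup[OF H])
  have "c *\<^sub>R x \<in> W" if "x \<in> W" for c x
  proof (cases c "0::real" rule: linorder_cases)
    case less
    thus ?thesis
      using pos[of "-c" "-x"] neg[OF that] by simp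
  qed (use pos[of c x] that zero in simp_all)
  thus ?thesis
    using zero add by (simp add: subspace_def)
qed

lemma horizontal_subspace:
  assumes H: "heisenberg n H" and V: "horizontal_subgroup H V"
  shows "subspace V"
proof -
  have sg: "subgroup V (hgroup H)" and L1: "V \<subseteq> layer1 H"
    and dil: "\<And>t x. t > 0 \<Longrightarrow> x \<in> V \<Longrightarrow> dilation H t x \<in> V"
    using V by (auto simp: horizontal_subgroup_def homogeneous_subgroup_def)
  have s1: "subspace (layer1 H)" and s2: "subspace (layer2 H)"
    and int: "layer1 H \<inter> layer2 H = {0}"
    by (fact heisenbergD[OF H])+
  have zero: "0 \<in> V"
    using subgroup.one_closed[OF sg] by (simp add: hgroup_def)
  have add: "x + y \<in> V" if "x \<in> V" "y \<in> V" for x y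
  proof -
    let ?c = "(1/2) *\<^sub>R hbracket H x y"
    have m: "x + y + ?c \<in> V"
      using subgroup.m_closed[OF sg that] by (simp add: mult_hgroup)
    have "x + y + ?c - (x + y) \<in> layer1 H"
      using m that L1 s1 by (meson subsetD subspace_add subspace_diff)
    hence "?c \<in> layer1 H"
      by simp
    moreover have "?c \<in> layer2 H"
      using hbracket_layer2[OF H] s2 by (simp add: subspace_scale)
    ultimately have "?c \<in> {0}"
      unfolding int[symmetric] by (rule IntI)
    hence "?c = 0" by (rule singletonD)
    thus ?thesis using m by (simp only: add_0_right)
  qed
  have pos: "t *\<^sub>R x \<in> V" if "t > 0" "x \<in> V" for t x
    using dil[OF that] proj1_layer1[OF H, of x] that L1 by (auto simp: dilation_def)
  have neg: "- x \<in> V" if "x \<in> V" for x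
    using subgroup.m_inv_closed[OF sg that] by (simp add: inv_hgroup[OF H])
  have "c *\<^sub>R x \<in> V" if "x \<in> V" for c x
  proof (cases c "0::real" rule: linorder_cases)
    case less
    thus ?thesis
      using pos[of "-c" "-x"] neg[OF that] by simp
  qed (use pos[of c x] that zero in simp_all)
  thus ?thesis
    using zero add by (simp add: subspace_def)
qed


section \<open>Multivectors\<close>

text \<open>
  The exterior algebra over a space with orthonormal basis \<open>e 1, \<dots>, e N\<close>, in coordinates:
  \<open>a I\<close> is the coefficient of \<open>e\<^sub>I = e i\<^sub>1 \<and> \<dots> \<and> e i\<^sub>p\<close>, where
  \<open>I = {i\<^sub>1 < \<dots> < i\<^sub>p} \<subseteq> {1..N}\<close>.  The wedge product is the bilinear extension of
  \<open>e\<^sub>I \<and> e\<^sub>J = (-1)^r e\<^bsub>I \<union> J\<^esub>\<close> for disjoint \<open>I\<close> and \<open>J\<close>, with \<open>r\<close> the number of inversions of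
  the concatenation, and \<open>e\<^sub>I \<and> e\<^sub>J = 0\<close> otherwise.  The induced norm makes the \<open>e\<^sub>I\<close> orthonormal.
\<close>

type_synonym multivector = "nat set \<Rightarrow> real"

definition mv_sign :: "nat set \<Rightarrow> nat set \<Rightarrow> real" where
  "mv_sign I J = (-1) ^ card {(i, j). i \<in> I \<and> j \<in> J \<and> j < i}"

definition mv_wedge :: "multivector \<Rightarrow> multivector \<Rightarrow> multivector" (infixr \<open>\<and>\<^sub>m\<close> 70) where
  "(a \<and>\<^sub>m b) K = (\<Sum>I\<in>Pow K. mv_sign I (K - I) * a I * b (K - I))"

definition mv_one :: multivector where
  "mv_one I = of_bool (I = {})"

definition mv_vec :: "nat \<Rightarrow> (nat \<Rightarrow> 'a::euclidean_space) \<Rightarrow> 'a \<Rightarrow> multivector" where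
  "mv_vec N e x I = (\<Sum>i\<in>{1..N}. of_bool (I = {i}) * (x \<bullet> e i))"

definition mv_list :: "nat \<Rightarrow> (nat \<Rightarrow> 'a::euclidean_space) \<Rightarrow> 'a list \<Rightarrow> multivector" where
  "mv_list N e xs = foldr (\<lambda>x a. mv_vec N e x \<and>\<^sub>m a) xs mv_one"

definition mv_norm :: "nat \<Rightarrow> multivector \<Rightarrow> real" where
  "mv_norm N a = sqrt (\<Sum>I\<in>Pow {1..N}. (a I)\<^sup>2)"

definition orthonormal_basis_list :: "'a::euclidean_space list \<Rightarrow> 'a set \<Rightarrow> bool" where
  "orthonormal_basis_list xs S \<longleftrightarrow>
     distinct xs \<and> pairwise orthogonal (set xs) \<and> (\<forall>x\<in>set xs. norm x = 1) \<and> span (set xs) = S"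


section \<open>Hausdorff measure\<close>

text \<open>
  The factor \<open>unit_ball_vol p / 2 ^ p\<close> is the usual normalization: by the isodiametric inequality,
  it makes the \<open>p\<close>-dimensional Hausdorff measure agree with Lebesgue measure on \<open>p\<close>-dimensional
  subspaces.  Only bounded sets are admitted in coverings, since \<open>diameter\<close> is meaningful
  for those only.
\<close>

definition hausdorff_gauge :: "nat \<Rightarrow> 'a::euclidean_space set \<Rightarrow> ennreal" where
  "hausdorff_gauge p E =
     (if E = {} then 0 else ennreal (unit_ball_vol (real p) / 2 ^ p * diameter E ^ p))"

definition hausdorff_pre :: "nat \<Rightarrow> real \<Rightarrow> 'a::euclidean_space set \<Rightarrow> ennreal" where
  "hausdorff_pre p \<delta> A =
     (INF E\<in>{E :: nat \<Rightarrow> 'a set. A \<subseteq> (\<Union>i. E i) \<and> (\<forall>i. bounded (E i) \<and> diameter (E i) \<le> \<delta>)}.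
        \<Sum>i. hausdorff_gauge p (E i))"

definition hausdorff_outer :: "nat \<Rightarrow> 'a::euclidean_space set \<Rightarrow> ennreal" where
  "hausdorff_outer p A = (SUP \<delta>\<in>{0<..}. hausdorff_pre p \<delta> A)"

definition hausdorff :: "nat \<Rightarrow> 'a::euclidean_space measure" where
  "hausdorff p = measure_of UNIV (sets borel) (hausdorff_outer p)"

text \<open>
  The outer measure is additive on separated sets, so by Caratheodory's criterion \<open>hausdorff p\<close>
  is a measure, with value \<open>hausdorff_outer p A\<close> at every Borel set \<open>A\<close>
  (\<open>emeasure_hausdorff\<close>).
\<close>

lemma hausdorff_pre_mono: "A \<subseteq> B \<Longrightarrow> hausdorff_pre p \<delta> A \<le> hausdorff_pre p \<delta> B"
  unfolding hausdorff_pre_def by (rule INF_superset_mono) auto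

lemma hausdorff_pre_antimono: "\<delta> \<le> \<epsilon> \<Longrightarrow> hausdorff_pre p \<epsilon> A \<le> hausdorff_pre p \<delta> A"
  unfolding hausdorff_pre_def by (rule INF_superset_mono) (auto intro: order_trans)

lemma hausdorff_pre_subadditive:
  "hausdorff_pre p \<delta> (\<Union>n::nat. A n) \<le> (\<Sum>n. hausdorff_pre p \<delta> (A n))"
proof (rule ennreal_le_epsilon)
  fix e :: real
  assume e: "0 < e" and "(\<Sum>n. hausdorff_pre p \<delta> (A n)) < top_class.top"
  hence *: "hausdorff_pre p \<delta> (A n) < hausdorff_pre p \<delta> (A n) + e * (1/2) ^ Suc n" for n
    by (auto simp: less_top dest!: ennreal_suminf_lessD)
  have "\<exists>E::nat \<Rightarrow> 'a set. A n \<subseteq> (\<Union>i. E i) \<and> (\<forall>i. bounded (E i) \<and> diameter (E i) \<le> \<delta>) \<and>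
           (\<Sum>i. hausdorff_gauge p (E i)) < hausdorff_pre p \<delta> (A n) + e * (1/2) ^ Suc n" for n
    using *[of n] unfolding hausdorff_pre_def INF_less_iff by auto
  then obtain E :: "nat \<Rightarrow> nat \<Rightarrow> 'a set" where
    cov: "\<And>n. A n \<subseteq> (\<Union>i. E n i)" and
    bd: "\<And>n i. bounded (E n i) \<and> diameter (E n i) \<le> \<delta>" and
    le: "\<And>n. (\<Sum>i. hausdorff_gauge p (E n i)) < hausdorff_pre p \<delta> (A n) + e * (1/2) ^ Suc n"
    by metis
  define C where "C = case_prod E o prod_decode"
  have "hausdorff_pre p \<delta> (\<Union>n. A n) \<le> (\<Sum>i. hausdorff_gauge p (C i))"
    unfolding hausdorff_pre_def
  proof (rule INF_lower, safe)
    fix x n assume "x \<in> A n"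
    then obtain i where "x \<in> E n i" using cov by blast
    hence "x \<in> C (prod_encode (n, i))" by (simp add: C_def)
    thus "x \<in> (\<Union>i. C i)" by blast
  qed (use bd in \<open>auto simp: C_def split: prod.splits\<close>)
  also have "\<dots> = (\<Sum>n. \<Sum>i. hausdorff_gauge p (E n i))"
    unfolding C_def comp_def by (intro suminf_ennreal_2dimen) (auto split: prod.splits)
  also have "\<dots> \<le> (\<Sum>n. hausdorff_pre p \<delta> (A n) + e * (1/2) ^ Suc n)"
    by (intro suminf_le less_imp_le le) auto
  also have "\<dots> = (\<Sum>n. hausdorff_pre p \<delta> (A n)) + (\<Sum>n. ennreal e * ennreal ((1/2) ^ Suc n))"
    using e by (subst suminf_add[symmetric])
      (auto simp del: ennreal_suminf_cmult simp add: ennreal_mult[symmetric])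
  also have "\<dots> = (\<Sum>n. hausdorff_pre p \<delta> (A n)) + e"
    unfolding ennreal_suminf_cmult
    by (subst suminf_ennreal_eq[OF zero_le_power power_half_series]) auto
  finally show "hausdorff_pre p \<delta> (\<Union>n. A n) \<le> (\<Sum>n. hausdorff_pre p \<delta> (A n)) + e" .
qed

lemma hausdorff_outer_mono: "A \<subseteq> B \<Longrightarrow> hausdorff_outer p A \<le> hausdorff_outer p B"
  unfolding hausdorff_outer_def by (intro SUP_mono) (auto intro: hausdorff_pre_mono)

lemma hausdorff_pre_le_outer: "\<delta> > 0 \<Longrightarrow> hausdorff_pre p \<delta> A \<le> hausdorff_outer p A"
  unfolding hausdorff_outer_def by (rule SUP_upper) auto

lemma hausdorff_outer_subadditive:
  "hausdorff_outer p (\<Union>n::nat. A n) \<le> (\<Sum>n. hausdorff_outer p (A n))"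
proof -
  have "hausdorff_pre p \<delta> (\<Union>n. A n) \<le> (\<Sum>n. hausdorff_outer p (A n))" if "\<delta> > 0" for \<delta>
    using order_trans[OF hausdorff_pre_subadditive suminf_le[OF hausdorff_pre_le_outer[OF that]]]
    by simp
  thus ?thesis
    unfolding hausdorff_outer_def[of p "\<Union>n. A n"] by (intro SUP_least) auto
qed

lemma hausdorff_outer_empty: "hausdorff_outer p ({} :: 'a::euclidean_space set) = 0"
proof -
  have "hausdorff_pre p \<delta> ({} :: 'a set) \<le> (\<Sum>i::nat. hausdorff_gauge p ({} :: 'a set))" if "\<delta> > 0" for \<delta>
    unfolding hausdorff_pre_def
    by (rule INF_lower2[of "\<lambda>_. {}"]) (use that in auto)
  hence "hausdorff_pre p \<delta> ({} :: 'a set) = 0" if "\<delta> > 0" for \<delta>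
    using that by (simp add: hausdorff_gauge_def)
  thus ?thesis
    unfolding hausdorff_outer_def by (auto simp: cSUP_const)
qed

lemma hausdorff_outer_space: "outer_measure_space (Pow UNIV) (hausdorff_outer p)"
  unfolding outer_measure_space_def positive_def increasing_def countably_subadditive_def
  by (intro conjI ballI allI impI hausdorff_outer_empty hausdorff_outer_mono
      hausdorff_outer_subadditive)

lemma hausdorff_outer_Un: "hausdorff_outer p (A \<union> B) \<le> hausdorff_outer p A + hausdorff_outer p B"
proof -
  interpret P: sigma_algebra UNIV "Pow UNIV :: 'a set set"
    by (rule sigma_algebra_Pow)
  have "subadditive (Pow UNIV) (hausdorff_outer p :: 'a set \<Rightarrow> ennreal)"
    using hausdorff_outer_space[of p] unfolding outer_measure_space_def
    by (intro P.countably_subadditive_subadditive) blast+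
  hence "hausdorff_outer p (A \<union> (B - A)) \<le> hausdorff_outer p A + hausdorff_outer p (B - A)"
    by (rule subadditiveD) auto
  also have "\<dots> \<le> hausdorff_outer p A + hausdorff_outer p B"
    by (intro add_left_mono hausdorff_outer_mono) auto
  finally show ?thesis
    by simp
qed

lemma hausdorff_outer_separated:
  assumes d: "d > 0" and sep: "\<And>x y. x \<in> A \<Longrightarrow> y \<in> B \<Longrightarrow> d \<le> dist x y"
  shows "hausdorff_outer p A + hausdorff_outer p B \<le> hausdorff_outer p (A \<union> B)"
proof -
  have small: "hausdorff_pre p \<delta> A + hausdorff_pre p \<delta> B \<le> hausdorff_pre p \<delta> (A \<union> B)"
    if \<delta>: "0 < \<delta>" "\<delta> < d" for \<delta>
    unfolding hausdorff_pre_def[of p \<delta> "A \<union> B"]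
  proof (rule INF_greatest)
    fix E :: "nat \<Rightarrow> 'a set"
    assume "E \<in> {E. A \<union> B \<subseteq> (\<Union>i. E i) \<and> (\<forall>i. bounded (E i) \<and> diameter (E i) \<le> \<delta>)}"
    hence cov: "A \<union> B \<subseteq> (\<Union>i. E i)" and bd: "\<And>i. bounded (E i)" "\<And>i. diameter (E i) \<le> \<delta>"
      by auto
    define F where "F S i = (if E i \<inter> S = {} then {} else E i)" for S i
    have pre: "hausdorff_pre p \<delta> S \<le> (\<Sum>i. hausdorff_gauge p (F S i))" if S: "S \<subseteq> A \<union> B" for S
      unfolding hausdorff_pre_def
    proof (rule INF_lower, safe)
      fix x assume x: "x \<in> S"
      then obtain i where "x \<in> E i" using cov S by blast
      hence "x \<in> F S i" using x by (auto simp: F_def)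
      thus "x \<in> (\<Union>i. F S i)" by blast
    qed (use bd \<delta> in \<open>auto simp: F_def\<close>)
    have "hausdorff_gauge p (F A i) + hausdorff_gauge p (F B i) \<le> hausdorff_gauge p (E i)" for i
    proof -
      have "E i \<inter> A = {} \<or> E i \<inter> B = {}"
      proof (rule ccontr)
        assume "\<not> ?thesis"
        then obtain x y where xy: "x \<in> E i" "x \<in> A" "y \<in> E i" "y \<in> B" by blast
        have "d \<le> dist x y" using sep xy by blast
        also have "dist x y \<le> \<delta>"
          using diameter_bounded_bound[OF bd(1)[of i] xy(1,3)] bd(2)[of i] by linarith
        finally show False using \<delta> by simp
      qed
      thus ?thesis by (auto simp: F_def hausdorff_gauge_def)
    qed
    hence "(\<Sum>i. hausdorff_gauge p (F A i) + hausdorff_gauge p (F B i)) \<le> (\<Sum>i. hausdorff_gauge p (E i))"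
      by (intro suminf_le) auto
    thus "hausdorff_pre p \<delta> A + hausdorff_pre p \<delta> B \<le> (\<Sum>i. hausdorff_gauge p (E i))"
      using add_mono[OF pre[of A] pre[of B]] by (simp add: suminf_add[symmetric])
  qed
  have dir: "\<exists>k\<in>{0<..}. hausdorff_pre p i A + hausdorff_pre p j B
               \<le> hausdorff_pre p k A + hausdorff_pre p k B" if "i \<in> {0<..}" "j \<in> {0<..}" for i j
    using that by (intro bexI[of _ "min i j"] add_mono hausdorff_pre_antimono) auto
  have "hausdorff_outer p A + hausdorff_outer p B
        = (SUP \<delta>\<in>{0<..}. hausdorff_pre p \<delta> A + hausdorff_pre p \<delta> B)"
    unfolding hausdorff_outer_def by (rule SUP_add_directed_ennreal[symmetric, OF dir])
  also have "\<dots> \<le> hausdorff_outer p (A \<union> B)"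
  proof (rule SUP_least)
    fix \<delta> :: real assume \<delta>: "\<delta> \<in> {0<..}"
    let ?m = "min \<delta> (d / 2)"
    have "hausdorff_pre p \<delta> A + hausdorff_pre p \<delta> B \<le> hausdorff_pre p ?m A + hausdorff_pre p ?m B"
      by (intro add_mono hausdorff_pre_antimono) auto
    also have "\<dots> \<le> hausdorff_pre p ?m (A \<union> B)"
      using \<delta> d by (intro small) auto
    also have "\<dots> \<le> hausdorff_outer p (A \<union> B)"
      using \<delta> d by (intro hausdorff_pre_le_outer) auto
    finally show "hausdorff_pre p \<delta> A + hausdorff_pre p \<delta> B \<le> hausdorff_outer p (A \<union> B)" .
  qed
  finally show ?thesis .
qed

lemma hausdorff_outer_closed:
  fixes F :: "'a::euclidean_space set"
  assumes "closed F"
  shows "hausdorff_outer p (X \<inter> F) + hausdorff_outer p (X - F) \<le> hausdorff_outer p X"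
proof (cases "F = {} \<or> hausdorff_outer p X = top_class.top")
  case True
  thus ?thesis by (auto simp: hausdorff_outer_empty)
next
  case False
  hence F: "F \<noteq> {}" and fin: "hausdorff_outer p X < top_class.top"
    by (auto simp: less_top)
  define g where "g x = infdist x F" for x
  have lip: "g x - g y \<le> dist x y" for x y
    using infdist_triangle[of x F y] by (simp add: g_def)
  define Y where "Y n = {x\<in>X. 1 / real (n + 1) \<le> g x}" for n
  define R where "R n = {x\<in>X. 1 / real (n + 2) \<le> g x \<and> g x < 1 / real (n + 1)}" for n
  have gap: "1 / real (m + 2) < 1 / real (m + 1)" for m :: nat
    by (simp add: field_simps)
  have Rsep: "1 / real (i + 2) - 1 / real (i + 3) \<le> dist x y"
    if "x \<in> R i" "y \<in> R j" "i + 2 \<le> j" for x y i j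
  proof -
    have "1 / real (j + 1) \<le> 1 / real (i + 3)"
      using that(3) by (intro divide_left_mono) auto
    thus ?thesis
      using that lip[of x y] by (auto simp: R_def)
  qed
  have par: "(\<Sum>i<m. hausdorff_outer p (R (2 * i + c))) \<le> hausdorff_outer p (\<Union>i<m. R (2 * i + c))" for m c
  proof (induction m)
    case 0 show ?case by simp
  next
    case (Suc m)
    have "(\<Sum>i<Suc m. hausdorff_outer p (R (2 * i + c)))
          \<le> hausdorff_outer p (\<Union>i<m. R (2 * i + c)) + hausdorff_outer p (R (2 * m + c))"
      using Suc by (simp add: add_mono)
    also have "\<dots> \<le> hausdorff_outer p ((\<Union>i<m. R (2 * i + c)) \<union> R (2 * m + c))"
    proof (cases m)
      case 0
      thus ?thesis by (simp add: hausdorff_outer_empty)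
    next
      case (Suc m')
      show ?thesis
      proof (rule hausdorff_outer_separated)
        show "0 < 1 / real (2 * m' + c + 2) - 1 / real (2 * m' + c + 3)"
          unfolding diff_gt_0_iff_gt by (rule frac_less2) auto
        fix x y assume "x \<in> (\<Union>i<m. R (2 * i + c))" and y: "y \<in> R (2 * m + c)"
        then obtain i where i: "i < m" "x \<in> R (2 * i + c)" by blast
        have "1 / real (2 * m' + c + 2) \<le> 1 / real (2 * i + c + 2)"
          using i Suc by (intro divide_left_mono) auto
        hence "1 / real (2 * m' + c + 2) \<le> g x"
          using i(2) by (auto simp: R_def)
        moreover have "g y < 1 / real (2 * m' + c + 3)"
          using y Suc by (auto simp: R_def ac_simps)
        ultimately show "1 / real (2 * m' + c + 2) - 1 / real (2 * m' + c + 3) \<le> dist x y"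
          using lip[of x y] by linarith
      qed
    qed
    also have "(\<Union>i<m. R (2 * i + c)) \<union> R (2 * m + c) = (\<Union>i<Suc m. R (2 * i + c))"
      by (auto simp: lessThan_Suc)
    finally show ?case .
  qed
  have par': "(\<Sum>i<m. hausdorff_outer p (R (2 * i + c))) \<le> hausdorff_outer p X" for m c
    by (rule order_trans[OF par hausdorff_outer_mono]) (auto simp: R_def)
  let ?f = "\<lambda>n. hausdorff_outer p (R n)"
  have two: "(\<Sum>n<2 * m. ?f n) = (\<Sum>i<m. ?f (2 * i + 0)) + (\<Sum>i<m. ?f (2 * i + 1))" for m
    by (induction m) (simp_all add: algebra_simps)
  have "(\<Sum>n<m. ?f n) \<le> hausdorff_outer p X + hausdorff_outer p X" for m
  proof -
    have "(\<Sum>n<m. ?f n) \<le> (\<Sum>n<2 * m. ?f n)"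
      by (intro sum_mono2) auto
    also have "\<dots> \<le> hausdorff_outer p X + hausdorff_outer p X"
      unfolding two by (intro add_mono par')
    finally show ?thesis .
  qed
  hence "(\<Sum>n. ?f n) \<le> hausdorff_outer p X + hausdorff_outer p X"
    by (intro suminf_le_const) auto
  hence fin': "(\<Sum>n. ?f n) \<noteq> \<infinity>"
    using fin by (auto simp: top_unique)
  have Ysep: "hausdorff_outer p (X \<inter> F) + hausdorff_outer p (Y n) \<le> hausdorff_outer p X" for n
  proof -
    have "hausdorff_outer p (X \<inter> F) + hausdorff_outer p (Y n) \<le> hausdorff_outer p (X \<inter> F \<union> Y n)"
    proof (rule hausdorff_outer_separated)
      fix x y assume "x \<in> X \<inter> F" "y \<in> Y n"
      thus "1 / real (n + 1) \<le> dist x y"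
        using lip[of y x] by (auto simp: Y_def g_def dist_commute)
    qed simp
    also have "\<dots> \<le> hausdorff_outer p X"
      by (rule hausdorff_outer_mono) (auto simp: Y_def)
    finally show ?thesis .
  qed
  have cover: "X - F \<subseteq> Y n \<union> (\<Union>k. R (k + n))" for n
  proof
    fix x assume x: "x \<in> X - F"
    hence pos: "g x > 0"
      unfolding g_def using assms F infdist_pos_not_in_closed by blast
    show "x \<in> Y n \<union> (\<Union>k. R (k + n))"
    proof (cases "1 / real (n + 1) \<le> g x")
      case True
      thus ?thesis using x by (auto simp: Y_def)
    next
      case nY: False
      define N where "N = (LEAST N. 1 / real (N + 1) \<le> g x)"
      obtain N0 where "1 / real (Suc N0) < g x"
        using nat_approx_posE[OF pos] by (metis)
      hence ex: "1 / real (N0 + 1) \<le> g x" by simp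
      have N: "1 / real (N + 1) \<le> g x"
        unfolding N_def by (rule LeastI[of _ N0]) (fact ex)
      have min: "\<not> 1 / real (m + 1) \<le> g x" if "m < N" for m
        using that unfolding N_def by (rule not_less_Least)
      have "n < N"
      proof (rule ccontr)
        assume "\<not> n < N"
        hence "1 / real (n + 1) \<le> 1 / real (N + 1)"
          by (intro divide_left_mono) auto
        with N nY show False by linarith
      qed
      then obtain k where k: "N = Suc (k + n)"
        by (metis add.commute less_iff_Suc_add)
      have "x \<in> R (k + n)"
        using x N min[of "k + n"] unfolding R_def k by (auto simp: add_ac)
      thus ?thesis by blast
    qed
  qed
  have sumY: "(\<Sum>k<n. ?f k) + hausdorff_outer p (X - F) \<le> hausdorff_outer p (Y n) + (\<Sum>k. ?f k)" for n
  proof -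
    have "hausdorff_outer p (X - F) \<le> hausdorff_outer p (Y n \<union> (\<Union>k. R (k + n)))"
      by (rule hausdorff_outer_mono[OF cover])
    also have "\<dots> \<le> hausdorff_outer p (Y n) + hausdorff_outer p (\<Union>k. R (k + n))"
      by (rule hausdorff_outer_Un)
    also have "\<dots> \<le> hausdorff_outer p (Y n) + (\<Sum>k. ?f (k + n))"
      by (intro add_left_mono hausdorff_outer_subadditive)
    finally have "(\<Sum>k<n. ?f k) + hausdorff_outer p (X - F)
        \<le> (\<Sum>k<n. ?f k) + (hausdorff_outer p (Y n) + (\<Sum>k. ?f (k + n)))"
      by (rule add_left_mono)
    also have "\<dots> = hausdorff_outer p (Y n) + (\<Sum>k. ?f k)"
      by (subst suminf_offset[of ?f n]) (simp_all add: ac_simps)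
    finally show ?thesis .
  qed
  have "(\<Sum>k. ?f k) + (hausdorff_outer p (X \<inter> F) + hausdorff_outer p (X - F))
        \<le> (\<Sum>k. ?f k) + hausdorff_outer p X"
  proof (rule ennreal_suminf_bound_add)
    fix n
    have "(\<Sum>k<n. ?f k) + (hausdorff_outer p (X \<inter> F) + hausdorff_outer p (X - F))
       = hausdorff_outer p (X \<inter> F) + ((\<Sum>k<n. ?f k) + hausdorff_outer p (X - F))"
      by (simp add: ac_simps)
    also have "\<dots> \<le> hausdorff_outer p (X \<inter> F) + (hausdorff_outer p (Y n) + (\<Sum>k. ?f k))"
      by (intro add_left_mono sumY)
    also have "\<dots> = (\<Sum>k. ?f k) + (hausdorff_outer p (X \<inter> F) + hausdorff_outer p (Y n))"
      by (simp add: ac_simps)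
    also have "\<dots> \<le> (\<Sum>k. ?f k) + hausdorff_outer p X"
      by (intro add_left_mono Ysep)
    finally show "(\<Sum>k<n. ?f k) + (hausdorff_outer p (X \<inter> F) + hausdorff_outer p (X - F))
        \<le> (\<Sum>k. ?f k) + hausdorff_outer p X" .
  qed
  thus ?thesis
    using fin' by (simp only: ennreal_add_left_cancel_le simp_thms)
qed

lemma sets_hausdorff [simp]: "sets (hausdorff p) = sets borel"
  using sets.sigma_sets_eq[of borel] by (simp add: hausdorff_def)

lemma space_hausdorff [simp]: "space (hausdorff p) = UNIV"
  by (simp add: hausdorff_def space_measure_of_conv)

lemma emeasure_hausdorff:
  fixes A :: "'a::euclidean_space set"
  assumes "A \<in> sets borel"
  shows "emeasure (hausdorff p) A = hausdorff_outer p A"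
proof -
  let ?L = "lambda_system UNIV (Pow UNIV) (hausdorff_outer p :: 'a set \<Rightarrow> ennreal)"
  interpret P: sigma_algebra UNIV "Pow UNIV :: 'a set set"
    by (rule sigma_algebra_Pow)
  have ms: "measure_space UNIV ?L (hausdorff_outer p)"
    by (rule P.caratheodory_lemma[OF hausdorff_outer_space])
  hence sa: "sigma_algebra UNIV ?L"
    by (simp add: measure_space_def)
  have "F \<in> ?L" if "closed F" for F
  proof -
    have "hausdorff_outer p (X \<inter> F) + hausdorff_outer p (X - F) = hausdorff_outer p X" for X
      using hausdorff_outer_closed[OF that, of p X]
        hausdorff_outer_Un[of p "X \<inter> F" "X - F"] by (simp add: Int_Diff_Un antisym)
    thus ?thesis
      unfolding P.lambda_system_eq by blast
  qed
  hence "sigma_sets UNIV (Collect closed) \<subseteq> ?L"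
    by (intro sigma_algebra.sigma_sets_subset[OF sa]) auto
  hence sub: "sets borel \<subseteq> ?L"
    by (simp add: borel_eq_closed)
  have "countably_additive (sets borel) (hausdorff_outer p :: 'a set \<Rightarrow> ennreal)"
    using ms sub unfolding measure_space_def countably_additive_def by blast
  moreover have "positive (sets borel) (hausdorff_outer p :: 'a set \<Rightarrow> ennreal)"
    by (simp add: positive_def hausdorff_outer_empty)
  moreover have "sigma_algebra UNIV (sets borel :: 'a set set)"
    by (metis sets.sigma_algebra_axioms space_borel)
  ultimately show ?thesis
    unfolding hausdorff_def by (intro emeasure_measure_of_sigma assms)
qed

end

theory Submission
  imports Defs
begin

text \<open>
  Let \<open>P : \<M> \<rightarrow> \<W>\<close> be the projection along \<open>\<V>\<close>, let \<open>Q\<close> be the unit cube of \<open>\<V>\<close> and \<open>B \<subseteq> \<M>\<close> a Borel set.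
  The linear sum \<open>B + Q\<close> is carried to \<open>P(B) + Q\<close> by \<open>m + v \<mapsto> P(m) + v\<close>.  Since \<open>P(m) - m\<close> lies in the span
  of \<open>\<V>\<close> and \<open>e\<^sub>2\<^sub>n\<^sub>+\<^sub>1\<close> and does not change when \<open>m + v\<close> is moved in these directions, this map is a shear
  and preserves Lebesgue measure.  On the other hand, by translation invariance and Fubini,
  \<open>H(B) |det T| = \<kappa> L(B + Q)\<close>, where \<open>T\<close> carries an orthonormal basis to the given bases of \<open>\<V>\<close> and \<open>\<M>\<close>,
  so that \<open>|det T|\<close> is the norm of \<open>V \<and> M\<close>; likewise for \<open>P(B)\<close>, \<open>\<W>\<close> and \<open>V \<and> N\<close>.  Here \<open>\<kappa>\<close> is the
  Hausdorff measure of the unit cube of a subspace of dimension \<open>2n + 1 - k\<close>.  Only its finiteness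
  matters, so the isodiametric inequality is not needed.
\<close>

section \<open>Multivectors\<close>

lemma mv_sign_Un_left:
  assumes "finite I" "finite J" "finite L" "I \<inter> J = {}"
  shows "mv_sign (I \<union> J) L = mv_sign I L * mv_sign J L"
proof -
  have "{(i, j). i \<in> I \<union> J \<and> j \<in> L \<and> j < i} =
      {(i, j). i \<in> I \<and> j \<in> L \<and> j < i} \<union> {(i, j). i \<in> J \<and> j \<in> L \<and> j < i}"
    by auto
  moreover have "finite {(i, j). i \<in> X \<and> j \<in> L \<and> j < i}" if "finite X" for X :: "nat set"
    by (rule finite_subset[of _ "X \<times> L"]) (use that assms in auto)
  ultimately show ?thesis
    unfolding mv_sign_def power_add[symmetric]
    by (subst card_Un_disjoint[symmetric]) (use assms in auto)
qed

lemma mv_sign_Un_right: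
  assumes "finite I" "finite J" "finite L" "J \<inter> L = {}"
  shows "mv_sign I (J \<union> L) = mv_sign I J * mv_sign I L"
proof -
  have "{(i, j). i \<in> I \<and> j \<in> J \<union> L \<and> j < i} =
      {(i, j). i \<in> I \<and> j \<in> J \<and> j < i} \<union> {(i, j). i \<in> I \<and> j \<in> L \<and> j < i}"
    by auto
  moreover have "finite {(i, j). i \<in> I \<and> j \<in> X \<and> j < i}" if "finite X" for X :: "nat set"
    by (rule finite_subset[of _ "I \<times> X"]) (use that assms in auto)
  ultimately show ?thesis
    unfolding mv_sign_def power_add[symmetric]
    by (subst card_Un_disjoint[symmetric]) (use assms in auto)
qed

text \<open>The sum over the infinite set \<open>Pow K\<close> takes the default value 0.\<close>

lemma mv_wedge_infinite: "infinite K \<Longrightarrow> (a \<and>\<^sub>m b) K = 0"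
  by (simp add: mv_wedge_def)

text \<open>Both sides are a sum over the ordered partitions of K into three sets I, J, L, weighted
  by the product of the three pairwise signs; \<open>?t\<close> is this common summand.\<close>

lemma mv_wedge_assoc: "(a \<and>\<^sub>m b) \<and>\<^sub>m c = a \<and>\<^sub>m (b \<and>\<^sub>m c)"
proof
  fix K :: "nat set"
  show "((a \<and>\<^sub>m b) \<and>\<^sub>m c) K = (a \<and>\<^sub>m (b \<and>\<^sub>m c)) K"
  proof (cases "finite K")
    case K: True
    let ?t = "\<lambda>I J L. mv_sign I J * mv_sign I L * mv_sign J L * a I * b J * c L"
    have fin: "finite X" if "X \<subseteq> K" for X
      using K that by (rule rev_finite_subset)
    have "((a \<and>\<^sub>m b) \<and>\<^sub>m c) K = (\<Sum>J\<in>Pow K. \<Sum>I\<in>Pow J. ?t I (J - I) (K - J))"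
      unfolding mv_wedge_def sum_distrib_left sum_distrib_right
    proof (intro sum.cong refl)
      fix I J assume "J \<in> Pow K" "I \<in> Pow J"
      hence "mv_sign J (K - J) = mv_sign I (K - J) * mv_sign (J - I) (K - J)"
        using mv_sign_Un_left[of I "J - I" "K - J"] fin K
        by (metis Diff_disjoint Diff_partition Pow_iff finite_Diff finite_subset)
      thus "mv_sign J (K - J) * (mv_sign I (J - I) * a I * b (J - I)) * c (K - J) =
          ?t I (J - I) (K - J)" by simp
    qed
    also have "\<dots> = (\<Sum>(J, I)\<in>Sigma (Pow K) Pow. ?t I (J - I) (K - J))"
      by (rule sum.Sigma) (use K fin in auto)
    \<comment> \<open>A chain I \<subseteq> J \<subseteq> K is recorded by I and the difference J -
      I.\<close>
    also have "\<dots> = (\<Sum>(I, J)\<in>(SIGMA I:Pow K. Pow (K - I)). ?t I J (K - I - J))"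
      by (rule sum.reindex_bij_witness[of _ "\<lambda>(I, J). (I \<union> J, I)" "\<lambda>(J, I). (I, J - I)"])
        (auto simp: Diff_Un Un_absorb1 Diff_Int_distrib Int_absorb2 intro!: arg_cong2[where f = "(*)"] arg_cong[where f = c] arg_cong[where f = "mv_sign _"])
    also have "\<dots> = (\<Sum>I\<in>Pow K. \<Sum>J\<in>Pow (K - I). ?t I J (K - I - J))"
      by (rule sum.Sigma[symmetric]) (use K fin in auto)
    also have "\<dots> = (a \<and>\<^sub>m (b \<and>\<^sub>m c)) K"
      unfolding mv_wedge_def sum_distrib_left sum_distrib_right
    proof (intro sum.cong refl)
      fix I J assume "I \<in> Pow K" "J \<in> Pow (K - I)"
      hence "mv_sign I (K - I) = mv_sign I J * mv_sign I (K - I - J)"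
        using mv_sign_Un_right[of I J "K - I - J"] fin K
        by (metis Diff_disjoint Diff_partition Pow_iff finite_Diff finite_subset)
      thus "?t I J (K - I - J) =
          mv_sign I (K - I) * a I * (mv_sign J (K - I - J) * b J * c (K - I - J))" by simp
    qed
    finally show ?thesis .
  qed (simp add: mv_wedge_infinite)
qed

text \<open>Only singletons {i} survive in the sum over \<open>Pow K\<close>, and the inversions of
  i against K - {i} are the elements of K below i. This is the Laplace expansion of a
  determinant.\<close>

lemma mv_vec_wedge:
  assumes "finite K"
  shows "(mv_vec N e x \<and>\<^sub>m a) K =
    (\<Sum>i\<in>K \<inter> {1..N}. (-1) ^ card {j\<in>K. j < i} * (x \<bullet> e i) * a (K - {i}))"
proof -
  let ?s = "\<lambda>i. (-1) ^ card {j\<in>K. j < i} * (x \<bullet> e i) * a (K - {i})"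
  have sgn: "mv_sign {i} (K - {i}) = (-1) ^ card {j\<in>K. j < i}" for i
  proof -
    have "{(i', j). i' \<in> {i} \<and> j \<in> K - {i} \<and> j < i'} = Pair i ` {j\<in>K. j < i}"
      by auto
    thus ?thesis
      by (simp add: mv_sign_def card_image inj_on_def)
  qed
  have "(mv_vec N e x \<and>\<^sub>m a) K = (\<Sum>I\<in>Pow K. \<Sum>i\<in>{1..N}. if I = {i} then ?s i else 0)"
    unfolding mv_wedge_def mv_vec_def sum_distrib_left sum_distrib_right
    by (intro sum.cong refl) (simp add: sgn)
  also have "\<dots> = (\<Sum>i\<in>{1..N}. \<Sum>I\<in>Pow K. if I = {i} then ?s i else 0)"
    by (rule sum.swap)
  also have "\<dots> = (\<Sum>i\<in>{1..N}. if i \<in> K then ?s i else 0)"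
    using assms by (intro sum.cong refl) (simp add: sum.delta)
  also have "\<dots> = (\<Sum>i\<in>{1..N} \<inter> K. ?s i)"
    by (simp add: sum.inter_restrict)
  finally show ?thesis
    by (simp only: Int_commute)
qed

section \<open>Bilinearity and alternation\<close>

lemma mv_wedge_zero [simp]: "a \<and>\<^sub>m (\<lambda>_. 0) = (\<lambda>_. 0)"
  by (rule ext) (simp add: mv_wedge_def)

lemma mv_wedge_add_left: "(\<lambda>I. a I + b I) \<and>\<^sub>m c = (\<lambda>I. (a \<and>\<^sub>m c) I + (b \<and>\<^sub>m c) I)"
  by (rule ext) (simp add: mv_wedge_def algebra_simps sum.distrib)

lemma mv_wedge_add_right: "a \<and>\<^sub>m (\<lambda>I. b I + c I) = (\<lambda>I. (a \<and>\<^sub>m b) I + (a \<and>\<^sub>m c) I)"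
  by (rule ext) (simp add: mv_wedge_def algebra_simps sum.distrib)

lemma mv_vec_add: "mv_vec N e (x + y) = (\<lambda>I. mv_vec N e x I + mv_vec N e y I)"
  by (rule ext) (simp add: mv_vec_def inner_left_distrib algebra_simps sum.distrib)

text \<open>Two expansions along x give a sum over ordered pairs of distinct indices in which (i, j)
  and (j, i) contribute opposite terms, so the sum equals its own negative.\<close>

lemma mv_vec_wedge_self: "mv_vec N e x \<and>\<^sub>m mv_vec N e x \<and>\<^sub>m a = (\<lambda>_. 0)"
proof
  fix K :: "nat set"
  show "(mv_vec N e x \<and>\<^sub>m mv_vec N e x \<and>\<^sub>m a) K = 0"
  proof (cases "finite K")
    case K: True
    let ?K = "K \<inter> {1..N}"
    let ?s = "\<lambda>K i. (-1) ^ card {j\<in>K. j < i} :: real"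
    let ?h = "\<lambda>(i, j). ?s K i * (x \<bullet> e i) * (?s (K - {i}) j * (x \<bullet> e j) * a (K - {i} - {j}))"
    let ?P = "SIGMA i:?K. ?K - {i}"
    have int: "(K - {i}) \<inter> {1..N} = ?K - {i}" for i
      by auto
    have eq: "(mv_vec N e x \<and>\<^sub>m mv_vec N e x \<and>\<^sub>m a) K = sum ?h ?P"
      using K by (simp add: mv_vec_wedge sum_distrib_left int sum.Sigma del: One_nat_def)
    \<comment> \<open>Deleting the larger index j keeps the rank of i in K, while deleting i lowers
      the rank of j by one; hence the minus sign.\<close>
    have less: "?h (i, j) = - ?h (j, i)" if "i \<in> K" "i < j" for i j
    proof -
      have "{l\<in>K - {j}. l < i} = {l\<in>K. l < i}"
        using that by auto
      moreover have "{l\<in>K. l < j} = insert i {l\<in>K - {i}. l < j}"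
        using that by auto
      hence "card {l\<in>K. l < j} = Suc (card {l\<in>K - {i}. l < j})"
        using K by simp
      ultimately show ?thesis
        by (simp add: insert_commute Diff_insert[symmetric])
    qed
    have "sum ?h ?P = (\<Sum>(i, j)\<in>?P. ?h (j, i))"
      by (rule sum.reindex_bij_witness[of _ prod.swap prod.swap]) auto
    also have "\<dots> = (\<Sum>q\<in>?P. - ?h q)"
    proof (intro sum.cong refl)
      fix q assume "q \<in> ?P"
      then obtain i j where q: "q = (i, j)" "i \<in> K" "j \<in> K" "i \<noteq> j" by auto
      show "(case q of (i, j) \<Rightarrow> ?h (j, i)) = - ?h q"
        using less[of i j] less[of j i] q by (cases "i < j") auto
    qed
    also have "\<dots> = - sum ?h ?P"
      by (rule sum_negf)
    finally show ?thesis
      unfolding eq by linarith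
  qed (simp add: mv_wedge_infinite)
qed

text \<open>Polarization: expand the vanishing product for x + y.\<close>

lemma mv_vec_wedge_swap:
  "mv_vec N e x \<and>\<^sub>m mv_vec N e y \<and>\<^sub>m a = (\<lambda>I. - (mv_vec N e y \<and>\<^sub>m mv_vec N e x \<and>\<^sub>m a) I)"
  using mv_vec_wedge_self[of N e "x + y" a]
  by (auto simp: mv_vec_add mv_wedge_add_left mv_wedge_add_right mv_vec_wedge_self fun_eq_iff
      add_eq_0_iff2 add_eq_0_iff)

section \<open>Wedges of lists of vectors as alternating multilinear functions\<close>

lemma mv_list_Cons: "mv_list N e (x # xs) = mv_vec N e x \<and>\<^sub>m mv_list N e xs"
  by (simp add: mv_list_def)

lemma mv_list_append: "mv_list N e (xs @ ys) = mv_list N e xs \<and>\<^sub>m mv_list N e ys"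
proof (induction xs)
  case Nil
  \<comment> \<open>A wedge product is 0 at every infinite index set, so \<open>mv_one\<close> is a
    left unit only for multivectors vanishing there. Wedges of lists do.\<close>
  have "(mv_one \<and>\<^sub>m a) K = (a :: multivector) K" if "finite K" for a K
  proof -
    have "(mv_one \<and>\<^sub>m a) K = (\<Sum>I\<in>Pow K. if I = {} then a K else 0)"
      unfolding mv_wedge_def
      by (intro sum.cong refl) (auto simp: mv_one_def mv_sign_def)
    thus ?thesis using that by simp
  qed
  moreover have "mv_list N e ys K = 0" if "infinite K" for K
    using that by (cases ys) (auto simp: mv_list_Cons mv_wedge_infinite mv_list_def mv_one_def)
  ultimately have "mv_list N e ys = mv_one \<and>\<^sub>m mv_list N e ys"
    using mv_wedge_infinite by (metis ext)
  thus ?case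
    by (simp add: mv_list_def[of N e "[]"])
qed (simp add: mv_list_Cons mv_wedge_assoc)

text \<open>Each expansion along a vector removes one index, until only the empty set, the support
  of \<open>mv_one\<close>, is left: wedges of vectors are homogeneous.\<close>

lemma mv_list_support:
  assumes "mv_list N e xs K \<noteq> 0"
  shows "finite K \<and> card K = length xs"
  using assms
proof (induction xs arbitrary: K)
  case Nil
  thus ?case by (auto simp: mv_list_def mv_one_def)
next
  case (Cons x xs)
  have K: "finite K"
    using Cons.prems mv_wedge_infinite by (metis mv_list_Cons)
  then obtain i where "i \<in> K" "mv_list N e xs (K - {i}) \<noteq> 0"
    using Cons.prems by (auto simp: mv_list_Cons mv_vec_wedge elim: sum.not_neutral_contains_not_neutral)
  thus ?case
    using Cons.IH[of "K - {i}"] K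
    using card_Suc_Diff1[OF K \<open>i \<in> K\<close>] by simp
qed

text \<open>By homogeneity only the top coefficient can be nonzero, so this norm is the absolute
  value of a determinant.\<close>

lemma mv_norm_top:
  assumes "length xs = N"
  shows "mv_norm N (mv_list N e xs) = \<bar>mv_list N e xs {1..N}\<bar>"
proof -
  have "mv_list N e xs I = 0" if "I \<in> Pow {1..N} - {{1..N}}" for I
    using mv_list_support[of N e xs I] that assms card_subset_eq[of "{1..N}" I] by auto
  hence "(\<Sum>I\<in>Pow {1..N}. (mv_list N e xs I)\<^sup>2) = (mv_list N e xs {1..N})\<^sup>2"
    by (subst sum.remove[of _ "{1..N}"]) auto
  thus ?thesis by (simp add: mv_norm_def)
qed

lemma linear_mv_list: "linear (\<lambda>x. mv_list N e (xs @ x # ys) K)"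
proof (induction xs arbitrary: K)
  case Nil
  have "linear (\<lambda>x. mv_vec N e x I)" for I
    by (rule linearI, simp only: mv_vec_add,
      simp only: mv_vec_def sum_distrib_left inner_scaleR_left mult.left_commute real_scaleR_def)
  hence "linear (\<lambda>x. c * mv_vec N e x I * d)" for c d I
    by (auto simp: linear_iff algebra_simps)
  thus ?case
    by (auto simp: mv_list_Cons mv_wedge_def intro!: linear_compose_sum)
next
  case (Cons z xs)
  hence "linear (\<lambda>x. c * mv_list N e (xs @ x # ys) I)" for c I
    by (auto simp: linear_iff algebra_simps)
  thus ?case
    by (auto simp: mv_list_Cons mv_wedge_def intro!: linear_compose_sum)
qed

text \<open>Swaps move the first of two equal entries to the right until it stands next to the
  second, where the product vanishes.\<close>

lemma mv_list_not_distinct: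
  assumes "\<not> distinct xs"
  shows "mv_list N e xs = (\<lambda>_. 0)"
proof -
  have front: "mv_list N e (x # ys @ x # zs) = (\<lambda>_. 0)" for x ys zs
  proof (induction ys)
    case (Cons y ys)
    thus ?case
      by (simp add: mv_list_Cons mv_vec_wedge_swap[of N e x y])
  qed (simp add: mv_list_Cons mv_vec_wedge_self)
  obtain ws x ys zs where "xs = ws @ [x] @ ys @ [x] @ zs"
    using not_distinct_decomp[OF assms] by blast
  thus ?thesis
    using front[of x ys zs] by (simp add: mv_list_append[of N e ws])
qed

text \<open>Expand by linearity in slot i: every term with j \<noteq> i contains
  \<open>xs ! j\<close> twice and vanishes. This yields the determinant of the elementary maps in
  \<open>linear_scaling_factor\<close>.\<close>

lemma mv_list_update:
  assumes "i < length xs"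
  shows "mv_list N e (xs[i := \<Sum>j<length xs. c j *\<^sub>R xs ! j]) K = c i * mv_list N e xs K"
proof -
  define f where "f x = mv_list N e (xs[i := x]) K" for x
  have "linear f"
    using linear_mv_list[of N e "take i xs" "drop (Suc i) xs" K] assms
    by (simp add: f_def[abs_def] upd_conv_take_nth_drop)
  hence "f (\<Sum>j<length xs. c j *\<^sub>R xs ! j) = (\<Sum>j<length xs. c j * f (xs ! j))"
    by (simp add: linear_sum linear_cmul)
  also have "\<dots> = (\<Sum>j<length xs. if j = i then c i * mv_list N e xs K else 0)"
  proof (intro sum.cong refl)
    fix j assume j: "j \<in> {..<length xs}"
    have "\<not> distinct (xs[i := xs ! j])" if "j \<noteq> i"
      using that j assms by (metis length_list_update lessThan_iff nth_eq_iff_index_eq nth_list_update_eq nth_list_update_neq)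
    thus "c j * f (xs ! j) = (if j = i then c i * mv_list N e xs K else 0)"
      by (auto simp: f_def mv_list_not_distinct)
  qed
  finally show ?thesis
    using assms by (simp add: f_def)
qed

text \<open>Downward induction on the first index i: it is the least element of {i..N}, so the
  expansion along \<open>e i\<close> has one nonzero term, with sign +1.\<close>

lemma mv_list_basis:
  assumes e: "\<And>i j. i \<in> {1..N} \<Longrightarrow> j \<in> {1..N} \<Longrightarrow> e i \<bullet> e j = of_bool (i = j)"
  shows "mv_list N e (map e [1..<Suc N]) {1..N} = 1"
proof -
  have "mv_list N e (map e [i..<Suc N]) {i..N} = 1" if "1 \<le> i" "i \<le> Suc N" for i
    using that(2,1)
  proof (induction rule: inc_induct)
    case base
    show ?case by (simp add: mv_list_def mv_one_def)
  next
    case (step i)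
    have no_less: "{j. i \<le> j \<and> j \<le> N \<and> j < i} = {}"
      by auto
    have "{i..N} \<inter> {1..N} = {i..N}" "{i..N} - {i} = {Suc i..N}"
      using step.prems by auto
    moreover have "(\<Sum>j\<in>{i..N}. (-1) ^ card {l\<in>{i..N}. l < j} * (e i \<bullet> e j) * h ({i..N} - {j}))
       = (\<Sum>j\<in>{i..N}. if j = i then (-1) ^ card {l\<in>{i..N}. l < i} * h ({i..N} - {i}) else 0)" for h :: multivector
      using step.prems step.hyps by (intro sum.cong refl) (auto simp: e)
    ultimately show ?case
      using step by (simp add: no_less upt_conv_Cons mv_list_Cons mv_vec_wedge del: upt_Suc)
  qed
  thus ?thesis by simp
qed

section \<open>Hausdorff measure of cubes\<close>

lemma hausdorff_outer_image_le:
  fixes f :: "'a::euclidean_space \<Rightarrow> 'a"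
  assumes f: "\<And>x y. x \<in> A \<Longrightarrow> y \<in> A \<Longrightarrow> dist (f x) (f y) \<le> dist x y"
  shows "hausdorff_outer p (f ` A) \<le> hausdorff_outer p A"
  unfolding hausdorff_outer_def
proof (rule SUP_mono)
  fix \<delta> :: real assume \<delta>: "\<delta> \<in> {0<..}"
  have "hausdorff_pre p \<delta> (f ` A) \<le> hausdorff_pre p \<delta> A"
    unfolding hausdorff_pre_def[of p \<delta> A]
  proof (rule INF_greatest)
    fix E :: "nat \<Rightarrow> 'a set"
    assume "E \<in> {E. A \<subseteq> (\<Union>i. E i) \<and> (\<forall>i. bounded (E i) \<and> diameter (E i) \<le> \<delta>)}"
    hence cov: "A \<subseteq> (\<Union>i. E i)" and bd: "\<And>i. bounded (E i)" "\<And>i. diameter (E i) \<le> \<delta>"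
      by auto
    \<comment> \<open>The map is nonexpansive on A only, so each covering set is first cut down to
      A.\<close>
    let ?F = "\<lambda>i. f ` (E i \<inter> A)"
    have dist: "dist x y \<le> diameter (E i)" if "x \<in> ?F i" "y \<in> ?F i" for x y i
    proof -
      from that obtain x' y' where *: "x' \<in> E i \<inter> A" "y' \<in> E i \<inter> A" "x = f x'" "y = f y'" by blast
      thus ?thesis
        using f[of x' y'] diameter_bounded_bound[OF bd(1)[of i], of x' y'] by auto
    qed
    have bF: "bounded (?F i)" for i
      using dist by (intro bounded_two_points[THEN iffD2] exI) blast
    have dF: "diameter (?F i) \<le> diameter (E i)" for i
      using dist[of _ i] diameter_ge_0[OF bd(1)[of i]] by (intro diameter_le) (auto simp: dist_norm)
    have "hausdorff_pre p \<delta> (f ` A) \<le> (\<Sum>i. hausdorff_gauge p (?F i))"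
      unfolding hausdorff_pre_def
    proof (rule INF_lower, intro CollectI conjI allI)
      show "f ` A \<subseteq> (\<Union>i. ?F i)"
        using cov by blast
    qed (use bF order_trans[OF dF bd(2)] in blast)+
    also have "\<dots> \<le> (\<Sum>i. hausdorff_gauge p (E i))"
    proof (intro suminf_le)
      fix i
      have "unit_ball_vol (real p) / 2 ^ p * diameter (?F i) ^ p
          \<le> unit_ball_vol (real p) / 2 ^ p * diameter (E i) ^ p"
        using dF[of i] diameter_ge_0[OF bF[of i]] by (intro mult_left_mono power_mono) auto
      thus "hausdorff_gauge p (?F i) \<le> hausdorff_gauge p (E i)"
        by (cases "E i = {}") (auto simp: hausdorff_gauge_def intro: ennreal_leI simp del: times_divide_eq_left)
    qed auto
    finally show "hausdorff_pre p \<delta> (f ` A) \<le> (\<Sum>i. hausdorff_gauge p (E i))" .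
  qed
  thus "\<exists>\<delta>'\<in>{0<..}. hausdorff_pre p \<delta> (f ` A) \<le> hausdorff_pre p \<delta>' A"
    using \<delta> by blast
qed

lemma hausdorff_outer_isometry:
  fixes f :: "'a::euclidean_space \<Rightarrow> 'a"
  assumes f: "\<And>x y. x \<in> A \<Longrightarrow> y \<in> A \<Longrightarrow> dist (f x) (f y) = dist x y"
  shows "hausdorff_outer p (f ` A) = hausdorff_outer p A"
proof (rule antisym)
  show "hausdorff_outer p (f ` A) \<le> hausdorff_outer p A"
    using f by (intro hausdorff_outer_image_le) simp
  have inj: "inj_on f A"
    using f by (metis dist_eq_0_iff inj_onI)
  have "hausdorff_outer p (inv_into A f ` f ` A) \<le> hausdorff_outer p (f ` A)"
    using f inj by (intro hausdorff_outer_image_le) auto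
  thus "hausdorff_outer p A \<le> hausdorff_outer p (f ` A)"
    using inj by (simp add: inv_into_image_cancel)
qed

text \<open>The family is numbered and padded with empty sets, whose gauge is 0 even for p =
  0.\<close>

lemma hausdorff_pre_finite_cover:
  fixes F :: "'b \<Rightarrow> 'a::euclidean_space set"
  assumes "finite I" "A \<subseteq> (\<Union>i\<in>I. F i)" "0 \<le> \<delta>"
    and "\<And>i. i \<in> I \<Longrightarrow> bounded (F i) \<and> diameter (F i) \<le> \<delta>"
  shows "hausdorff_pre p \<delta> A \<le> (\<Sum>i\<in>I. hausdorff_gauge p (F i))"
proof -
  obtain h where h: "bij_betw h {0..<card I} I"
    using ex_bij_betw_nat_finite[OF assms(1)] by blast
  define E where "E n = (if n < card I then F (h n) else {})" for n
  have hI: "h n \<in> I" if "n < card I" for n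
    using h that by (auto simp: bij_betw_def)
  have "A \<subseteq> (\<Union>n. E n)"
  proof
    fix x assume "x \<in> A"
    then obtain i where i: "i \<in> I" "x \<in> F i" using assms(2) by blast
    moreover obtain n where "n < card I" "h n = i"
      using h i(1) unfolding bij_betw_def by (metis atLeastLessThan_iff imageE)
    ultimately have "x \<in> E n" by (simp add: E_def)
    thus "x \<in> (\<Union>n. E n)" by blast
  qed
  hence "hausdorff_pre p \<delta> A \<le> (\<Sum>n. hausdorff_gauge p (E n))"
    unfolding hausdorff_pre_def
    by (intro INF_lower) (use assms(3,4) hI in \<open>auto simp: E_def\<close>)
  also have "\<dots> = (\<Sum>n\<in>{0..<card I}. hausdorff_gauge p (E n))"
    by (rule suminf_finite) (auto simp: E_def hausdorff_gauge_def)
  also have "\<dots> = (\<Sum>i\<in>I. hausdorff_gauge p (F i))"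
    using sum.reindex_bij_betw[OF h, of "\<lambda>i. hausdorff_gauge p (F i)"] by (simp add: E_def)
  finally show ?thesis .
qed

section \<open>Orthonormal sets and their unit cubes\<close>

definition unit_cube :: "'a::euclidean_space set \<Rightarrow> 'a set" where
  "unit_cube X = {x \<in> span X. \<forall>u\<in>X. 0 \<le> x \<bullet> u \<and> x \<bullet> u \<le> 1}"

definition orthonormal :: "'a::euclidean_space set \<Rightarrow> bool" where
  "orthonormal X \<longleftrightarrow> (\<forall>u\<in>X. \<forall>v\<in>X. u \<bullet> v = of_bool (u = v))"

lemma orthonormal_finite: "orthonormal X \<Longrightarrow> finite X"
  by (rule pairwise_orthogonal_imp_finite) (auto simp: orthonormal_def pairwise_def orthogonal_def)

lemma orthonormal_inner_sum:
  assumes "orthonormal X" "u \<in> X"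
  shows "(\<Sum>v\<in>X. c v *\<^sub>R v) \<bullet> u = c u"
proof -
  have "(\<Sum>v\<in>X. c v *\<^sub>R v) \<bullet> u = (\<Sum>v\<in>X. if v = u then c u else 0)"
    unfolding inner_sum_left using assms by (intro sum.cong refl) (auto simp: orthonormal_def)
  thus ?thesis
    using assms orthonormal_finite[OF assms(1)] by simp
qed

lemma orthonormal_representation:
  assumes "orthonormal X" "x \<in> span X"
  shows "(\<Sum>u\<in>X. (x \<bullet> u) *\<^sub>R u) = x"
proof -
  obtain c where "x = (\<Sum>u\<in>X. c u *\<^sub>R u)"
    using assms(2) by (auto simp: span_finite[OF orthonormal_finite[OF assms(1)]])
  thus ?thesis
    using orthonormal_inner_sum[OF assms(1)] by simp
qed

lemma orthonormal_norm_sum: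
  assumes "orthonormal X"
  shows "(norm (\<Sum>v\<in>X. c v *\<^sub>R v))\<^sup>2 = (\<Sum>v\<in>X. (c v)\<^sup>2)"
  unfolding power2_norm_eq_inner inner_sum_right
  by (simp add: orthonormal_inner_sum[OF assms] power2_eq_square)

lemma orthonormal_independent:
  assumes "orthonormal X"
  shows "independent X"
proof (rule pairwise_orthogonal_independent)
  show "pairwise orthogonal X"
    using assms by (simp add: orthonormal_def pairwise_def orthogonal_def)
  show "0 \<notin> X"
    using assms by (force simp: orthonormal_def)
qed

lemma orthonormal_basis_listD:
  assumes "orthonormal_basis_list xs S"
  shows "orthonormal (set xs)" "distinct xs" "span (set xs) = S"
proof -
  note xs = assms[unfolded orthonormal_basis_list_def]
  have "u \<bullet> v = of_bool (u = v)" if "u \<in> set xs" "v \<in> set xs" for u v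
    using xs that by (cases "u = v") (simp_all add: norm_eq_1 pairwise_def orthogonal_def)
  thus "orthonormal (set xs)"
    by (simp add: orthonormal_def)
  show "distinct xs" "span (set xs) = S"
    using xs by blast+
qed

lemma closed_unit_cube: "closed (unit_cube X)"
proof -
  have "unit_cube X = span X \<inter> (\<Inter>u\<in>X. {x. 0 \<le> x \<bullet> u} \<inter> {x. x \<bullet> u \<le> 1})"
    by (auto simp: unit_cube_def)
  thus ?thesis
    by (simp only:) (intro closed_Int closed_INT ballI closed_subspace subspace_span closed_Collect_le continuous_intros)
qed

text \<open>A bijection \<open>h\<close> of the two orthonormal sets extends to a linear map that is
  isometric on the span of X and carries one cube onto the other. It makes the constant \<kappa> the
  same for both vertical subgroups.\<close>

lemma hausdorff_outer_unit_cube_eq: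
  fixes X Y :: "'a::euclidean_space set"
  assumes X: "orthonormal X" and Y: "orthonormal Y" and "card X = card Y"
  shows "hausdorff_outer p (unit_cube X) = hausdorff_outer p (unit_cube Y)"
proof -
  obtain h where h: "bij_betw h X Y"
    using assms(3) bij_betw_iff_card[OF orthonormal_finite[OF X] orthonormal_finite[OF Y]] by blast
  define f where "f x = (\<Sum>u\<in>X. (x \<bullet> u) *\<^sub>R h u)" for x
  have f': "f x = (\<Sum>v\<in>Y. (x \<bullet> inv_into X h v) *\<^sub>R v)" for x
    unfolding f_def using h
    by (subst sum.reindex_bij_betw[OF h, symmetric]) (auto simp: bij_betw_def intro!: sum.cong)
  have inner: "f x \<bullet> h u = x \<bullet> u" if "u \<in> X" for x u
    unfolding f' using h that by (subst orthonormal_inner_sum[OF Y]) (auto simp: bij_betw_def)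
  have diff: "f x - f y = f (x - y)" for x y
    by (simp add: f_def inner_diff_left scaleR_diff_left sum_subtractf)
  have norm: "norm (f x) = norm x" if "x \<in> span X" for x
  proof -
    have "(norm (f x))\<^sup>2 = (\<Sum>v\<in>Y. (x \<bullet> inv_into X h v)\<^sup>2)"
      unfolding f' by (rule orthonormal_norm_sum[OF Y])
    also have "\<dots> = (\<Sum>u\<in>X. (x \<bullet> u)\<^sup>2)"
      using h by (subst sum.reindex_bij_betw[OF h, symmetric]) (auto simp: bij_betw_def intro!: sum.cong)
    also have "\<dots> = (norm x)\<^sup>2"
      using orthonormal_norm_sum[OF X, of "\<lambda>u. x \<bullet> u"] orthonormal_representation[OF X that] by simp
    finally show ?thesis by simp
  qed
  have "f ` unit_cube X = unit_cube Y"
  proof (intro equalityI subsetI)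
    fix y assume "y \<in> f ` unit_cube X"
    then obtain x where x: "x \<in> unit_cube X" "y = f x" by blast
    have "y \<in> span Y"
      unfolding x f' by (intro span_sum span_scale span_base)
    thus "y \<in> unit_cube Y"
      using x inner h unfolding unit_cube_def bij_betw_def by force
  next
    fix y assume y: "y \<in> unit_cube Y"
    define x where "x = (\<Sum>u\<in>X. (y \<bullet> h u) *\<^sub>R u)"
    have xu: "x \<bullet> u = y \<bullet> h u" if "u \<in> X" for u
      unfolding x_def by (rule orthonormal_inner_sum[OF X that])
    have "x \<in> span X"
      unfolding x_def by (intro span_sum span_scale span_base)
    moreover have "f x = (\<Sum>v\<in>Y. (y \<bullet> v) *\<^sub>R v)"
      unfolding f_def by (simp add: xu sum.reindex_bij_betw[OF h, of "\<lambda>v. (y \<bullet> v) *\<^sub>R v"])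
    hence "f x = y"
      using y orthonormal_representation[OF Y] by (simp add: unit_cube_def)
    ultimately show "y \<in> f ` unit_cube X"
      using y xu h by (auto simp: unit_cube_def bij_betw_def intro!: image_eqI[of _ _ x])
  qed
  moreover have "hausdorff_outer p (f ` unit_cube X) = hausdorff_outer p (unit_cube X)"
    by (intro hausdorff_outer_isometry) (auto simp: dist_norm diff unit_cube_def norm span_diff)
  ultimately show ?thesis by simp
qed

text \<open>Cut the cube into m^p cells of side 1/m. The triangle inequality bounds their diameter
  by p/m, and the powers of m cancel in the sum of the gauges, which leaves the bound C for every
  \<delta>.\<close>

lemma hausdorff_outer_unit_cube_finite:
  fixes X :: "'a::euclidean_space set"
  assumes X: "orthonormal X" and p: "card X = p"
  shows "hausdorff_outer p (unit_cube X) < \<infinity>"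
proof -
  define C where "C = unit_ball_vol (real p) / 2 ^ p * real p ^ p"
  have C0: "0 \<le> C" by (simp add: C_def)
  have fin: "finite X" by (rule orthonormal_finite[OF X])
  have "hausdorff_pre p \<delta> (unit_cube X) \<le> ennreal C" if "\<delta> > 0" for \<delta>
  proof -
    obtain m0 :: nat where "real p / \<delta> < real m0"
      using reals_Archimedean2 by blast
    define m where "m = Suc m0"
    have m: "m > 0" "real p / real m \<le> \<delta>"
      using \<open>real p / \<delta> < real m0\<close> that by (auto simp: m_def field_simps)
    define F where "F i = {x \<in> span X. \<forall>u\<in>X. real (i u) \<le> real m * (x \<bullet> u) \<and> real m * (x \<bullet> u) \<le> real (i u) + 1}"
      for i :: "'a \<Rightarrow> nat"
    have dist: "norm (x - y) \<le> real p / real m" if "x \<in> F i" "y \<in> F i" for x y i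
    proof -
      have xy: "x - y \<in> span X"
        using that by (auto simp: F_def intro: span_diff)
      have "norm (x - y) \<le> (\<Sum>u\<in>X. norm (((x - y) \<bullet> u) *\<^sub>R u))"
        using norm_sum[of "\<lambda>u. ((x - y) \<bullet> u) *\<^sub>R u" X] orthonormal_representation[OF X xy] by simp
      also have "\<dots> \<le> (\<Sum>u\<in>X. 1 / real m)"
      proof (rule sum_mono)
        fix u assume u: "u \<in> X"
        have "norm u = 1"
          using X u by (simp add: orthonormal_def norm_eq_1)
        moreover have "real m * \<bar>(x - y) \<bullet> u\<bar> \<le> 1"
        proof -
          have "real m * ((x - y) \<bullet> u) = real m * (x \<bullet> u) - real m * (y \<bullet> u)"
            by (simp add: inner_diff_left algebra_simps)
          hence "\<bar>real m * ((x - y) \<bullet> u)\<bar> \<le> 1"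
            using that u by (force simp: F_def)
          thus ?thesis by (simp add: abs_mult)
        qed
        ultimately show "norm (((x - y) \<bullet> u) *\<^sub>R u) \<le> 1 / real m"
          using m by (simp add: field_simps)
      qed
      finally show ?thesis by (simp add: p)
    qed
    have bF: "bounded (F i)" for i
      using dist unfolding bounded_two_points dist_norm by blast
    have dF: "diameter (F i) \<le> real p / real m" for i
      using dist by (intro diameter_le) auto
    let ?I = "X \<rightarrow>\<^sub>E {..<m}"
    have "unit_cube X \<subseteq> (\<Union>i\<in>?I. F i)"
    proof
      fix x assume x: "x \<in> unit_cube X"
      \<comment> \<open>At x \<bullet> u = 1 the floor is m, one past the last cell. The cells are
        closed, so the minimum with m - 1 assigns such a point to the last one.\<close>
      define i where "i = restrict (\<lambda>u. min (m - 1) (nat \<lfloor>real m * (x \<bullet> u)\<rfloor>)) X"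
      have "real (i u) \<le> real m * (x \<bullet> u) \<and> real m * (x \<bullet> u) \<le> real (i u) + 1" if u: "u \<in> X" for u
      proof -
        have *: "0 \<le> real m * (x \<bullet> u)" "real m * (x \<bullet> u) \<le> real m"
          using x u m by (auto simp: unit_cube_def mult_left_le)
        have f: "real (nat \<lfloor>real m * (x \<bullet> u)\<rfloor>) \<le> real m * (x \<bullet> u)"
          "real m * (x \<bullet> u) \<le> real (nat \<lfloor>real m * (x \<bullet> u)\<rfloor>) + 1"
          using *(1) by linarith+
        show ?thesis
        proof (cases "nat \<lfloor>real m * (x \<bullet> u)\<rfloor> \<le> m - 1")
          case True
          thus ?thesis using f u by (simp add: i_def)
        next
          case False
          hence "real m - 1 \<le> real m * (x \<bullet> u)"
            using f(1) m by linarith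
          moreover have "real (i u) = real m - 1"
            using False u m by (simp add: i_def of_nat_diff)
          ultimately show ?thesis using *(2) by linarith
        qed
      qed
      hence "x \<in> F i"
        using x by (simp add: F_def unit_cube_def)
      moreover have "i \<in> ?I"
        using m by (auto simp: i_def)
      ultimately show "x \<in> (\<Union>i\<in>?I. F i)" by blast
    qed
    hence "hausdorff_pre p \<delta> (unit_cube X) \<le> (\<Sum>i\<in>?I. hausdorff_gauge p (F i))"
      using fin bF order_trans[OF dF m(2)] that
      by (intro hausdorff_pre_finite_cover) (auto intro: finite_PiE)
    also have "\<dots> \<le> (\<Sum>i\<in>?I. ennreal (C / real m ^ p))"
    proof (rule sum_mono)
      fix i
      have "diameter (F i) ^ p \<le> (real p / real m) ^ p"
        using dF diameter_ge_0[OF bF] by (intro power_mono)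
      hence "unit_ball_vol (real p) / 2 ^ p * diameter (F i) ^ p \<le> C / real m ^ p"
        using mult_left_mono[of "diameter (F i) ^ p" "(real p / real m) ^ p" "unit_ball_vol (real p) / 2 ^ p"]
        by (simp add: C_def power_divide)
      thus "hausdorff_gauge p (F i) \<le> ennreal (C / real m ^ p)"
        by (auto simp: hausdorff_gauge_def intro: ennreal_leI)
    qed
    also have "\<dots> = ennreal (\<Sum>i\<in>?I. C / real m ^ p)"
      using C0 by (intro sum_ennreal) simp
    also have "(\<Sum>i\<in>?I. C / real m ^ p) = C"
      using fin m by (simp add: card_PiE p)
    finally show ?thesis .
  qed
  hence "hausdorff_outer p (unit_cube X) \<le> ennreal C"
    unfolding hausdorff_outer_def by (intro SUP_least) auto
  thus ?thesis
    using le_less_trans[OF _ ennreal_less_top] by (simp add: infinity_ennreal_def)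
qed

section \<open>Shears and linear maps\<close>

lemma borel_measurable_linear:
  fixes f :: "'a::euclidean_space \<Rightarrow> 'b::euclidean_space"
  assumes "linear f"
  shows "f \<in> borel_measurable borel"
  using assms linear_continuous_on[of f UNIV]
  by (intro borel_measurable_continuous_onI) (auto simp: linear_conv_bounded_linear)

lemma nn_integral_lborel_translate:
  fixes a :: "'a::euclidean_space"
  assumes [measurable]: "f \<in> borel_measurable borel"
  shows "(\<integral>\<^sup>+x. f (x + a) \<partial>lborel) = (\<integral>\<^sup>+x. f x \<partial>lborel)"
proof -
  have "(\<integral>\<^sup>+x. f x \<partial>lborel) = (\<integral>\<^sup>+x. f x \<partial>distr lborel borel ((+) a))"
    by (simp add: lborel_distr_plus)
  also have "\<dots> = (\<integral>\<^sup>+x. f (x + a) \<partial>lborel)"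
    by (subst nn_integral_distr) (simp_all add: add.commute)
  finally show ?thesis ..
qed

text \<open>
  Fubini is applied against the auxiliary density \<open>q\<close> of total mass 1, so that no product decomposition
  of the space along the range of \<open>p\<close> is needed.
\<close>

lemma nn_integral_shear:
  fixes g p :: "'a::euclidean_space \<Rightarrow> 'a"
  assumes p: "linear p"
    and [measurable]: "g \<in> borel_measurable borel" "f \<in> borel_measurable borel"
    and pg: "\<And>x. p (g x) = g x" and inv: "\<And>x y. g (x + p y) = g x"
  shows "(\<integral>\<^sup>+x. f (x + g x) \<partial>lborel) = (\<integral>\<^sup>+x. f x \<partial>lborel)"
proof -
  note [measurable] = borel_measurable_linear[OF p]
  define q :: "'a \<Rightarrow> ennreal" where "q = indicator (cbox 0 One)"
  have [measurable]: "q \<in> borel_measurable borel"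
    unfolding q_def by measurable
  have q: "(\<integral>\<^sup>+y. q y \<partial>lborel) = 1"
    by (simp add: q_def emeasure_lborel_cbox_eq)
  have trans: "(\<integral>\<^sup>+y. h (y + a) \<partial>lborel) = (\<integral>\<^sup>+y. h y \<partial>lborel)"
    if "h \<in> borel_measurable borel" for h :: "'a \<Rightarrow> ennreal" and a
    by (rule nn_integral_lborel_translate[OF that])
  have inv': "g (x - p y) = g x" for x y
    using inv[of "x - p y" y] by simp
  have p_add: "p (x + y) = p x + p y" for x y
    by (rule linear_add[OF p])
  have "(\<integral>\<^sup>+x. f (x + g x) \<partial>lborel) = (\<integral>\<^sup>+x. \<integral>\<^sup>+y. f (x + g x) * q y \<partial>lborel \<partial>lborel)"
    by (simp add: nn_integral_cmult q)
  \<comment> \<open>From here on each change of variables is a translation of one variable by a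
    vector that depends only on the other, with Fubini in between to make that variable the inner
    one.\<close>
  also have "\<dots> = (\<integral>\<^sup>+x. \<integral>\<^sup>+y. f (x + g x) * q (y + (p x + g x)) \<partial>lborel \<partial>lborel)"
    by (rule nn_integral_cong, rule trans[symmetric]) measurable
  also have "\<dots> = (\<integral>\<^sup>+y. \<integral>\<^sup>+x. f (x + g x) * q (y + (p x + g x)) \<partial>lborel \<partial>lborel)"
    by (rule lborel_pair.Fubini') simp
  \<comment> \<open>Moving x by a value of \<open>p\<close> leaves \<open>g x\<close>
    unchanged.\<close>
  also have "\<dots> = (\<integral>\<^sup>+y. \<integral>\<^sup>+x. f (x + - p y + g (x + - p y)) * q (y + (p (x + - p y) + g (x + - p y))) \<partial>lborel \<partial>lborel)"
    by (rule nn_integral_cong, rule trans[symmetric]) measurable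
  also have "\<dots> = (\<integral>\<^sup>+x. \<integral>\<^sup>+y. f (x - p y + g x) * q (y - p (p y) + p x + g x) \<partial>lborel \<partial>lborel)"
    by (subst lborel_pair.Fubini') (simp_all add: inv' p_add linear_diff[OF p] algebra_simps)
  \<comment> \<open>As \<open>p (g x) = g x\<close>, moving y by \<open>g x\<close> turns
    \<open>p y\<close> into \<open>p y + g x\<close>, which cancels the \<open>g x\<close> in the
    argument of f.\<close>
  also have "\<dots> = (\<integral>\<^sup>+x. \<integral>\<^sup>+y. f (x - p (y + g x) + g x) * q ((y + g x) - p (p (y + g x)) + p x + g x) \<partial>lborel \<partial>lborel)"
    by (rule nn_integral_cong, rule trans[symmetric]) measurable
  also have "\<dots> = (\<integral>\<^sup>+y. \<integral>\<^sup>+x. f (x - p y) * q (y - p (p y) + p x + g x) \<partial>lborel \<partial>lborel)"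
    by (subst lborel_pair.Fubini') (simp_all add: p_add pg algebra_simps)
  \<comment> \<open>Moving x back by \<open>p y\<close> clears the argument of f. The terms
    \<open>p (p y)\<close> cancel in q, whose argument becomes a translate of y again.\<close>
  also have "\<dots> = (\<integral>\<^sup>+y. \<integral>\<^sup>+x. f ((x + p y) - p y) * q (y - p (p y) + p (x + p y) + g (x + p y)) \<partial>lborel \<partial>lborel)"
    by (rule nn_integral_cong, rule trans[symmetric]) measurable
  also have "\<dots> = (\<integral>\<^sup>+x. \<integral>\<^sup>+y. f x * q (y + (p x + g x)) \<partial>lborel \<partial>lborel)"
    by (subst lborel_pair.Fubini') (simp_all add: p_add inv algebra_simps)
  also have "\<dots> = (\<integral>\<^sup>+x. \<integral>\<^sup>+y. f x * q y \<partial>lborel \<partial>lborel)"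
  proof (rule nn_integral_cong)
    fix x
    show "(\<integral>\<^sup>+y. f x * q (y + (p x + g x)) \<partial>lborel) = (\<integral>\<^sup>+y. f x * q y \<partial>lborel)"
      by (rule trans[of "\<lambda>y. f x * q y"]) measurable
  qed
  also have "\<dots> = (\<integral>\<^sup>+x. f x \<partial>lborel)"
    by (simp add: nn_integral_cmult q)
  finally show ?thesis .
qed

lemma emeasure_lborel_shear:
  fixes g p :: "'a::euclidean_space \<Rightarrow> 'a"
  assumes "linear p" and [measurable]: "g \<in> borel_measurable borel" "A \<in> sets borel"
    and "\<And>x. p (g x) = g x" "\<And>x y. g (x + p y) = g x"
  shows "emeasure lborel {x. x + g x \<in> A} = emeasure lborel A"
proof -
  have "{x. x + g x \<in> A} \<in> sets lborel"
    by measurable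
  hence "emeasure lborel {x. x + g x \<in> A} = (\<integral>\<^sup>+x. indicator {x. x + g x \<in> A} x \<partial>lborel)"
    by (rule nn_integral_indicator[symmetric])
  also have "\<dots> = (\<integral>\<^sup>+x. indicator A (x + g x) \<partial>lborel)"
    by (intro nn_integral_cong) (simp add: indicator_def)
  also have "\<dots> = (\<integral>\<^sup>+x. indicator A x \<partial>lborel)"
    by (rule nn_integral_shear[OF assms(1)]) (use assms in auto)
  finally show ?thesis by simp
qed

section \<open>Volume and wedge products under linear maps\<close>

lemma linear_image_borel:
  fixes T :: "'a::euclidean_space \<Rightarrow> 'a"
  assumes "linear T" "inj T" "A \<in> sets borel"
  shows "T ` A \<in> sets borel"
proof -
  obtain U where U: "linear U" "\<And>x. U (T x) = x" "\<And>x. T (U x) = x"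
    using linear_injective_isomorphism[OF assms(1,2)] by blast
  have "T ` A = U -` A \<inter> space borel"
    using U(2,3) by (auto intro!: image_eqI[of _ T "U _"])
  thus ?thesis
    using measurable_sets[OF borel_measurable_linear[OF U(1)] assms(3)] by simp
qed

text \<open>The map is diagonal in the standard basis, with entry a at b and 1 elsewhere.\<close>

lemma emeasure_lborel_scale_direction:
  fixes b :: "'a::euclidean_space"
  assumes b: "b \<in> Basis" and a: "a \<noteq> 0" and A: "A \<in> sets borel"
  shows "emeasure lborel ((\<lambda>x. x + ((a - 1) * (x \<bullet> b)) *\<^sub>R b) ` A) = ennreal \<bar>a\<bar> * emeasure lborel A"
proof -
  let ?c = "\<lambda>j. if j = b then a else 1"
  define T where "T x = x + ((a - 1) * (x \<bullet> b)) *\<^sub>R b" for x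
  have T: "T x = 0 + (\<Sum>j\<in>Basis. (?c j * (x \<bullet> j)) *\<^sub>R j)" for x
  proof -
    have "(\<Sum>j\<in>Basis. (?c j * (x \<bullet> j)) *\<^sub>R j) =
        (\<Sum>j\<in>Basis. (x \<bullet> j) *\<^sub>R j + (if j = b then ((a - 1) * (x \<bullet> b)) *\<^sub>R b else 0))"
      by (intro sum.cong refl) (simp add: algebra_simps)
    also have "\<dots> = T x"
      using b by (simp add: sum.distrib euclidean_representation T_def)
    finally show ?thesis by simp
  qed
  have Tb: "T x \<bullet> j = ?c j * (x \<bullet> j)" if "j \<in> Basis" for x j
    using that b by (simp add: T_def inner_add_left inner_Basis algebra_simps)
  have inj: "inj T"
  proof (rule injI, rule euclidean_eqI)
    fix x y j assume "T x = T y" and j: "j \<in> (Basis :: 'a set)"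
    hence "?c j * (x \<bullet> j) = ?c j * (y \<bullet> j)"
      using Tb[OF j] by metis
    thus "x \<bullet> j = y \<bullet> j"
      using a by (simp split: if_splits)
  qed
  have lin: "linear T"
    by (rule linearI) (simp_all add: T_def algebra_simps)
  note [measurable] = borel_measurable_linear[OF lin]
  have TA: "T ` A \<in> sets borel"
    by (rule linear_image_borel[OF lin inj A])
  have "(\<Prod>j\<in>Basis. \<bar>?c j\<bar>) = \<bar>a\<bar>"
    using b prod.delta[of Basis b "\<lambda>_. \<bar>a\<bar>"] by (simp add: if_distrib[of abs] cong: if_cong)
  moreover have "T = (\<lambda>x. 0 + (\<Sum>j\<in>Basis. (?c j * (x \<bullet> j)) *\<^sub>R j))"
    by (rule ext) (rule T)
  ultimately have "lborel = density (distr lborel borel T) (\<lambda>_. \<bar>a\<bar>)"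
    using lborel_affine_euclidean[of ?c 0] a by (simp only:) auto
  hence "emeasure lborel (T ` A) = emeasure (density (distr lborel borel T) (\<lambda>_. \<bar>a\<bar>)) (T ` A)"
    by (rule arg_cong)
  also have "\<dots> = ennreal \<bar>a\<bar> * emeasure lborel (T -` T ` A)"
    using TA by (simp add: emeasure_density_const emeasure_distr)
  also have "T -` T ` A = A"
    using inj by (simp add: inj_vimage_image_eq)
  finally show ?thesis
    by (simp add: T_def)
qed

text \<open>The number d is the determinant of T, obtained at once as the factor for volumes and,
  with its sign, as the factor for wedge products. Both are multiplicative, so a factorization of T
  into elementary maps suffices.\<close>

lemma linear_scaling_factor:
  fixes T :: "'a::euclidean_space \<Rightarrow> 'a"
  assumes bs: "set bs = Basis" "distinct bs" and "linear T" "inj T"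
  shows "\<exists>d. d \<noteq> 0 \<and>
    (\<forall>A\<in>sets borel. emeasure lborel (T ` A) = ennreal \<bar>d\<bar> * emeasure lborel A) \<and>
    (\<forall>S. linear S \<longrightarrow> mv_list N e (map (S \<circ> T) bs) K = d * mv_list N e (map S bs) K)"
proof -
  define D where "D xs = mv_list N e xs K" for xs
  \<comment> \<open>Allowing an arbitrary linear S in front of T, and not only the identity, makes
    this property stable under composition.\<close>
  define P where "P T \<longleftrightarrow> (\<exists>d. d \<noteq> 0 \<and>
      (\<forall>A\<in>sets borel. emeasure lborel (T ` A) = ennreal \<bar>d\<bar> * emeasure lborel A) \<and>
      (\<forall>S. linear S \<longrightarrow> D (map (S \<circ> T) bs) = d * D (map S bs)))" for T :: "'a \<Rightarrow> 'a"
  have P_comp: "P (T1 \<circ> T2)" if "P T1" "P T2" "linear T1" "linear T2" "inj T2" for T1 T2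
  proof -
    obtain d1 where d1: "d1 \<noteq> 0"
      "\<And>A. A \<in> sets borel \<Longrightarrow> emeasure lborel (T1 ` A) = ennreal \<bar>d1\<bar> * emeasure lborel A"
      "\<And>S. linear S \<Longrightarrow> D (map (S \<circ> T1) bs) = d1 * D (map S bs)"
      using \<open>P T1\<close> by (auto simp: P_def)
    obtain d2 where d2: "d2 \<noteq> 0"
      "\<And>A. A \<in> sets borel \<Longrightarrow> emeasure lborel (T2 ` A) = ennreal \<bar>d2\<bar> * emeasure lborel A"
      "\<And>S. linear S \<Longrightarrow> D (map (S \<circ> T2) bs) = d2 * D (map S bs)"
      using \<open>P T2\<close> by (auto simp: P_def)
    have "emeasure lborel ((T1 \<circ> T2) ` A) = ennreal \<bar>d1 * d2\<bar> * emeasure lborel A"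
      if "A \<in> sets borel" for A
      using d1(2)[OF linear_image_borel[OF \<open>linear T2\<close> \<open>inj T2\<close> that]] d2(2)[OF that]
      by (simp add: image_comp abs_mult ennreal_mult' mult.assoc)
    moreover have "D (map (S \<circ> (T1 \<circ> T2)) bs) = d1 * d2 * D (map S bs)" if "linear S" for S
      using d2(3)[of "S \<circ> T1"] d1(3)[of S] that \<open>linear T1\<close>
      by (simp add: linear_compose o_assoc)
    ultimately show ?thesis
      using d1(1) d2(1) unfolding P_def by (intro exI[of _ "d1 * d2"]) auto
  qed
  \<comment> \<open>\<open>R b u\<close> sends \<open>b\<close> to \<open>u\<close> and fixes the other basis vectors; by Gaussian elimination these maps
    generate all linear isomorphisms.\<close>
  define R where "R b u x = x + (x \<bullet> b) *\<^sub>R (u - b)" for b u x :: 'a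
  have linR: "linear (R b u)" for b u
    by (rule linearI) (simp_all add: R_def algebra_simps inner_add_left)
  \<comment> \<open>The b-coordinate of \<open>R b u x\<close> is that of x times u \<bullet> b.
    Dividing by u \<bullet> b recovers the multiple of u - b that was added.\<close>
  have R_inv: "R b (b - (u - b) /\<^sub>R (u \<bullet> b)) (R b u x) = x"
    if "b \<in> Basis" "u \<bullet> b \<noteq> 0" for b u x
  proof -
    have "R b u x \<bullet> b = (x \<bullet> b) * (u \<bullet> b)"
      using that by (simp add: R_def inner_add_left inner_diff_left algebra_simps)
    thus ?thesis
      using that by (simp add: R_def[of b "b - _"]) (simp add: R_def)
  qed
  have injR: "inj (R b u)" if "b \<in> Basis" "u \<bullet> b \<noteq> 0" for b u
    using R_inv[OF that] by (metis injI)
  have P_R: "P (R b u)" if b: "b \<in> Basis" and u: "u \<bullet> b \<noteq> 0" for b u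
  proof -
    have "emeasure lborel (R b u ` A) = ennreal \<bar>u \<bullet> b\<bar> * emeasure lborel A"
      if A: "A \<in> sets borel" for A
    proof -
      define a where "a = u \<bullet> b"
      \<comment> \<open>\<open>R b u\<close> is the scaling \<open>Sc\<close> by a along b, followed
        by a shear in the direction z, which is orthogonal to b.\<close>
      define z where "z = (u - a *\<^sub>R b) /\<^sub>R a"
      define Sc where "Sc x = x + ((a - 1) * (x \<bullet> b)) *\<^sub>R b" for x
      have a: "a \<noteq> 0" using u by (simp add: a_def)
      have zb: "z \<bullet> b = 0"
        using b by (simp add: z_def inner_diff_left a_def)
      have Scb: "Sc x \<bullet> b = a * (x \<bullet> b)" for x
        using b by (simp add: Sc_def inner_add_left algebra_simps)
      have R_eq: "R b u x = Sc x + (Sc x \<bullet> b) *\<^sub>R z" for x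
        using a unfolding Scb by (simp add: R_def Sc_def z_def algebra_simps)
      have "R b u ` A = {x. x + - ((x \<bullet> b) *\<^sub>R z) \<in> Sc ` A}"
      proof (intro equalityI subsetI)
        fix y assume "y \<in> R b u ` A"
        thus "y \<in> {x. x + - ((x \<bullet> b) *\<^sub>R z) \<in> Sc ` A}"
          using zb by (auto simp: R_eq inner_add_left)
      next
        fix y assume "y \<in> {x. x + - ((x \<bullet> b) *\<^sub>R z) \<in> Sc ` A}"
        then obtain x where x: "x \<in> A" "y + - ((y \<bullet> b) *\<^sub>R z) = Sc x" by blast
        have "Sc x \<bullet> b = y \<bullet> b"
          using zb by (simp add: x(2)[symmetric] inner_diff_left)
        hence "y = R b u x"
          by (simp add: R_eq x(2)[symmetric])
        thus "y \<in> R b u ` A" using x(1) by blast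
      qed
      moreover have "emeasure lborel {x. x + - ((x \<bullet> b) *\<^sub>R z) \<in> Sc ` A} = emeasure lborel (Sc ` A)"
      \<comment> \<open>The orthogonal projection along b fixes the multiples of z, and its values
        do not affect the b-coordinate, on which alone the shear depends.\<close>
      proof (rule emeasure_lborel_shear[of "\<lambda>x. x - (x \<bullet> b) *\<^sub>R b"])
        show "linear (\<lambda>x. x - (x \<bullet> b) *\<^sub>R b)"
          by (rule linearI) (simp_all add: algebra_simps inner_add_left)
        have "linear Sc"
          by (rule linearI) (simp_all add: Sc_def algebra_simps inner_add_left)
        moreover have "inj Sc"
        proof (rule injI)
          fix x y assume xy: "Sc x = Sc y"
          hence "x \<bullet> b = y \<bullet> b"
            using Scb[of x] Scb[of y] a by simp
          thus "x = y" using xy by (simp add: Sc_def)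
        qed
        ultimately show "Sc ` A \<in> sets borel"
          using A by (rule linear_image_borel)
      qed (use b zb in \<open>auto simp: inner_diff_left inner_add_left\<close>)
      moreover have "emeasure lborel (Sc ` A) = ennreal \<bar>a\<bar> * emeasure lborel A"
        unfolding Sc_def[abs_def] by (rule emeasure_lborel_scale_direction[OF b a A])
      ultimately show ?thesis by (simp add: a_def)
    qed
    moreover have "D (map (S \<circ> R b u) bs) = (u \<bullet> b) * D (map S bs)" if S: "linear S" for S
    proof -
      \<comment> \<open>\<open>R b u\<close> changes only the entry at b, from S b to S u. Expanding
        u in the basis makes S u a combination of all entries, with coefficient u \<bullet> b at
        this one.\<close>
      obtain i where i: "i < length bs" "bs ! i = b"
        using b bs by (metis in_set_conv_nth)
      have "S u = (\<Sum>v\<in>Basis. (u \<bullet> v) *\<^sub>R S v)"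
        using linear_sum[OF S, of "\<lambda>v. (u \<bullet> v) *\<^sub>R v" Basis]
        by (simp add: euclidean_representation linear_cmul[OF S])
      also have "\<dots> = (\<Sum>j<length bs. (u \<bullet> bs ! j) *\<^sub>R S (bs ! j))"
        unfolding bs(1)[symmetric]
        by (rule sum.reindex_bij_betw[OF bij_betw_nth[OF bs(2) refl refl], symmetric])
      finally have "map (S \<circ> R b u) bs =
          (map S bs)[i := \<Sum>j<length (map S bs). (u \<bullet> bs ! j) *\<^sub>R map S bs ! j]"
      proof (intro nth_equalityI)
        fix j assume *: "j < length (map (S \<circ> R b u) bs)"
          "S u = (\<Sum>j<length bs. (u \<bullet> bs ! j) *\<^sub>R S (bs ! j))"
        have "bs ! j \<bullet> b = of_bool (j = i)"
          using * i b bs nth_mem[of j bs] by (auto simp: inner_Basis nth_eq_iff_index_eq)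
        thus "map (S \<circ> R b u) bs ! j =
            (map S bs)[i := \<Sum>j<length (map S bs). (u \<bullet> bs ! j) *\<^sub>R map S bs ! j] ! j"
          using * i by (auto simp: R_def nth_list_update)
      qed simp
      thus ?thesis
        using mv_list_update[of i "map S bs" N e "\<lambda>j. u \<bullet> bs ! j" K] i by (simp add: D_def)
    qed
    ultimately show ?thesis
      using u unfolding P_def by blast
  qed
  have "P T" using \<open>linear T\<close> \<open>inj T\<close>
  proof (induction "card {b\<in>Basis. T b \<noteq> b}" arbitrary: T rule: less_induct)
    case less
    note T = less.prems
    show ?case
    proof (cases "\<forall>b\<in>Basis. T b = b")
      case True
      have "T = id"
        using linear_eq_stdbasis[OF T(1) linear_id] True by simp
      thus ?thesis
        unfolding P_def by (intro exI[of _ 1]) simp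
    next
      case False
      then obtain b where b: "b \<in> Basis" "T b \<noteq> b" by blast
      \<comment> \<open>With a nonzero pivot, composing U with the inverse of
        \<open>R b (U b)\<close> makes b fixed and keeps every basis vector fixed by T, so the
        induction hypothesis applies.\<close>
      have pivot: "P U" if U: "linear U" "inj U" "U b \<bullet> b \<noteq> 0"
        and fixed: "\<And>b'. b' \<in> Basis \<Longrightarrow> T b' = b' \<Longrightarrow> U b' = b'" for U
      proof -
        define w where "w = b - (U b - b) /\<^sub>R (U b \<bullet> b)"
        define U' where "U' = R b w \<circ> U"
        have wb: "w \<bullet> b \<noteq> 0"
        proof -
          have "w \<bullet> b = 1 - inverse (U b \<bullet> b) * (U b \<bullet> b - 1)"
            using b by (simp add: w_def inner_diff_left)
          thus ?thesis using U(3) by (auto simp: field_simps)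
        qed
        have RR: "R b w (R b (U b) x) = x" for x
          unfolding w_def by (rule R_inv[OF b(1) U(3)])
        have R_R: "R b (U b) (R b w x) = x" for x
          by (rule injD[OF injR[OF b(1) wb]]) (rule RR)
        have U': "linear U'" "inj U'"
          unfolding U'_def using linear_compose[OF U(1) linR] inj_compose[OF injR[OF b(1) wb] U(2)]
          by auto
        have "U' b = b"
          using RR[of b] b by (simp add: U'_def R_def)
        moreover have "U' b' = b'" if "b' \<in> Basis" "T b' = b'" for b'
        proof -
          have "b' \<noteq> b" using that b by blast
          thus ?thesis
            using that b fixed[OF that] by (simp add: U'_def R_def inner_Basis)
        qed
        ultimately have "{b'\<in>Basis. U' b' \<noteq> b'} \<subset> {b'\<in>Basis. T b' \<noteq> b'}"
          using b by blast
        hence "P U'"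
          by (intro less.hyps U' psubset_card_mono) simp_all
        moreover have "U = R b (U b) \<circ> U'"
          by (simp add: U'_def fun_eq_iff R_R)
        ultimately show ?thesis
          using P_comp[OF P_R[OF b(1) U(3)] _ linR U'] by simp
      qed
      show ?thesis
      proof (cases "T b \<bullet> b = 0")
        case False
        thus ?thesis using pivot[OF T] by blast
      next
        case True
        \<comment> \<open>Otherwise T b is a combination of basis vectors fixed by T, so T (T b) = T
          b, and injectivity gives T b = b.\<close>
        have "\<exists>b'\<in>Basis. T b' \<noteq> b' \<and> T b \<bullet> b' \<noteq> 0"
        proof (rule ccontr)
          assume *: "\<not> ?thesis"
          have "T b = (\<Sum>b'\<in>Basis. (T b \<bullet> b') *\<^sub>R b')"
            by (simp add: euclidean_representation)
          also have "\<dots> = (\<Sum>b'\<in>Basis. (T b \<bullet> b') *\<^sub>R T b')"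
            using * by (intro sum.cong refl) force
          also have "\<dots> = T (T b)"
            using linear_sum[OF T(1), of "\<lambda>v. (T b \<bullet> v) *\<^sub>R v" Basis]
            by (simp add: euclidean_representation linear_cmul[OF T(1)])
          finally show False
            using injD[OF T(2), of b "T b"] b(2) by simp
        qed
        then obtain b' where b': "b' \<in> Basis" "T b' \<noteq> b'" "T b \<bullet> b' \<noteq> 0" by blast
        have ne: "b \<noteq> b'" using True b' by blast
        have c: "(b' + b) \<bullet> b' \<noteq> 0" "(b' - b) \<bullet> b' \<noteq> 0"
          using b b' ne by (simp_all add: inner_add_left inner_diff_left inner_Basis)
        \<comment> \<open>This row operation adds the b'-coordinate to the b-coordinate and so
          creates a nonzero pivot. As T moves b', the basis vectors fixed by T remain fixed.\<close>
        define U where "U = R b' (b' + b) \<circ> T"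
        have U: "linear U" "inj U"
          unfolding U_def using linear_compose[OF T(1) linR] inj_compose[OF injR[OF b'(1) c(1)] T(2)]
          by auto
        have "P U"
        proof (rule pivot[OF U])
          show "U b \<bullet> b \<noteq> 0"
            using True b b' by (simp add: U_def R_def inner_add_left)
          fix v assume v: "v \<in> Basis" "T v = v"
          hence "v \<noteq> b'" using b' by blast
          thus "U v = v"
            using v b' by (simp add: U_def R_def inner_Basis)
        qed
        moreover have "T = R b' (b' - b) \<circ> U"
          using b b' ne by (auto simp: U_def R_def fun_eq_iff inner_add_left inner_Basis)
        ultimately show ?thesis
          using P_comp[OF P_R[OF b'(1) c(2)] _ linR U] by simp
      qed
    qed
  qed
  thus ?thesis
    unfolding P_def D_def .
qed

text \<open>The linear map from the standard basis to \<open>vs @ us\<close> carries the standard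
  unit cube onto the sum of the two cubes. The spans of \<open>vs\<close> and \<open>us\<close> may
  meet at any angle, which d measures.\<close>

lemma emeasure_lborel_split_cube:
  fixes vs us bs :: "'a::euclidean_space list"
  assumes bs: "set bs = Basis" "distinct bs"
    and vs: "orthonormal (set vs)" "distinct vs" and us: "orthonormal (set us)" "distinct us"
    and len: "length vs + length us = length bs"
    and p: "linear p" "\<And>x. p x \<in> span (set vs)" "\<And>x. x - p x \<in> span (set us)"
      "\<And>x. x \<in> span (set vs) \<Longrightarrow> p x = x" "\<And>x. x \<in> span (set us) \<Longrightarrow> p x = 0"
  shows "\<exists>d. d \<noteq> 0 \<and> mv_list N e (vs @ us) K = d * mv_list N e bs K \<and>
    emeasure lborel {y. y - p y \<in> unit_cube (set us) \<and> p y \<in> unit_cube (set vs)} = ennreal \<bar>d\<bar>"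
proof -
  define k where "k = length vs"
  define v where "v x = (\<Sum>i<k. (x \<bullet> bs ! i) *\<^sub>R vs ! i)" for x
  define u where "u x = (\<Sum>j<length us. (x \<bullet> bs ! (k + j)) *\<^sub>R us ! j)" for x
  define T where "T x = v x + u x" for x
  have lin: "linear T"
    by (rule linearI)
      (simp_all add: T_def v_def u_def inner_add_left scaleR_left_distrib sum.distrib
        scaleR_sum_right scaleR_right_distrib)
  have sum_inner: "(\<Sum>i<length xs. c i *\<^sub>R xs ! i) \<bullet> xs ! j = c j"
    if "orthonormal (set xs)" "distinct xs" "j < length xs" for xs :: "'a list" and c j
  proof -
    have "(\<Sum>i<length xs. c i *\<^sub>R xs ! i) \<bullet> xs ! j = (\<Sum>i<length xs. if i = j then c j else 0)"
      unfolding inner_sum_left using that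
      by (intro sum.cong refl) (auto simp: orthonormal_def nth_eq_iff_index_eq)
    thus ?thesis using that by simp
  qed
  have bs_inner: "bs ! i \<bullet> bs ! j = of_bool (i = j)" if "i < length bs" "j < length bs" for i j
    using that bs nth_mem[OF that(1)] nth_mem[OF that(2)] by (auto simp: inner_Basis nth_eq_iff_index_eq)
  have v_span: "v x \<in> span (set vs)" and u_span: "u x \<in> span (set us)" for x
    unfolding v_def u_def k_def by (intro span_sum span_scale span_base nth_mem; simp)+
  have pT: "p (T x) = v x" for x
    using p(4)[OF v_span] p(5)[OF u_span] by (simp add: T_def linear_add[OF p(1)])
  have T_nth: "T (bs ! i) = (vs @ us) ! i" if "i < length bs" for i
  proof (cases "i < k")
    case True
    have "v (bs ! i) = (\<Sum>j<k. if j = i then vs ! i else 0)"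
      unfolding v_def using True that len by (intro sum.cong refl) (auto simp: bs_inner k_def)
    moreover have "u (bs ! i) = 0"
      unfolding u_def using True that len by (intro sum.neutral) (auto simp: bs_inner k_def)
    ultimately show ?thesis
      using True by (simp add: T_def nth_append k_def)
  next
    case False
    have "v (bs ! i) = 0"
      unfolding v_def using False that len by (intro sum.neutral) (auto simp: bs_inner k_def)
    moreover have "u (bs ! i) = (\<Sum>j<length us. if j = i - k then us ! (i - k) else 0)"
      unfolding u_def using False that len by (intro sum.cong refl) (auto simp: bs_inner k_def)
    moreover have "i - k < length us"
      using False that len by (simp add: k_def)
    ultimately show ?thesis
      using False by (simp add: T_def nth_append k_def)
  qed
  have map_T: "map T bs = vs @ us"
    using len by (intro nth_equalityI) (auto simp: T_nth)
  have "set vs \<union> set us \<subseteq> range T"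
  proof -
    have "set (map T bs) \<subseteq> range T" by auto
    thus ?thesis by (simp only: map_T set_append)
  qed
  moreover have sub: "subspace (range T)"
    by (rule linear_subspace_image[OF lin subspace_UNIV])
  ultimately have "span (set vs) \<subseteq> range T" "span (set us) \<subseteq> range T"
    by (simp_all add: span_minimal)
  hence "(x - p x) + p x \<in> range T" for x
    using p(2,3) by (intro subspace_add[OF sub]) auto
  hence surj: "surj T"
    by auto
  have inj: "inj T"
    by (rule linear_surjective_imp_injective[OF lin surj refl])
  have cube: "(\<Sum>i<length xs. c i *\<^sub>R xs ! i) \<in> unit_cube (set xs) \<longleftrightarrow> (\<forall>i<length xs. 0 \<le> c i \<and> c i \<le> 1)"
    if "orthonormal (set xs)" "distinct xs" for xs :: "'a list" and c
  proof -
    have "(\<Sum>i<length xs. c i *\<^sub>R xs ! i) \<in> span (set xs)"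
      by (intro span_sum span_scale span_base nth_mem) simp
    thus ?thesis
      using sum_inner[OF that] by (auto simp: unit_cube_def all_set_conv_all_nth)
  qed
  have all_less_add: "(\<forall>i<k + m. P i) \<longleftrightarrow> (\<forall>i<k. P i) \<and> (\<forall>j<m. P (k + j))" for k m :: nat and P
  proof safe
    fix i assume *: "\<forall>i<k. P i" "\<forall>j<m. P (k + j)" "i < k + m"
    show "P i"
      using *(1,3) *(2)[rule_format, of "i - k"] by (cases "i < k") auto
  qed auto
  let ?S = "{y. y - p y \<in> unit_cube (set us) \<and> p y \<in> unit_cube (set vs)}"
  have mem: "T x \<in> ?S \<longleftrightarrow> x \<in> cbox 0 One" for x
  proof -
    have "T x \<in> ?S \<longleftrightarrow> v x \<in> unit_cube (set vs) \<and> u x \<in> unit_cube (set us)"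
      unfolding mem_Collect_eq pT by (auto simp: T_def)
    also have "\<dots> \<longleftrightarrow> (\<forall>i<length bs. 0 \<le> x \<bullet> bs ! i \<and> x \<bullet> bs ! i \<le> 1)"
      unfolding v_def u_def k_def cube[OF vs] cube[OF us] len[symmetric]
      by (rule all_less_add[symmetric])
    also have "\<dots> \<longleftrightarrow> x \<in> cbox 0 One"
      unfolding mem_box bs(1)[symmetric] all_set_conv_all_nth using bs(1) nth_mem[of _ bs] by auto
    finally show ?thesis .
  qed
  have S: "T ` cbox 0 One = ?S"
  proof (intro equalityI subsetI)
    fix y assume y: "y \<in> ?S"
    obtain x where "y = T x"
      using surj by (rule surjE)
    thus "y \<in> T ` cbox 0 One"
      using y mem[of x] by (simp del: mem_Collect_eq)
  qed (use mem in blast)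
  obtain d where d: "d \<noteq> 0"
    "\<forall>A\<in>sets borel. emeasure lborel (T ` A) = ennreal \<bar>d\<bar> * emeasure lborel A"
    "\<forall>S. linear S \<longrightarrow> mv_list N e (map (S \<circ> T) bs) K = d * mv_list N e (map S bs) K"
    using linear_scaling_factor[OF bs lin inj, of N e K] by blast
  have "emeasure lborel ?S = ennreal \<bar>d\<bar>"
    using d(2)[rule_format, of "cbox 0 One"] unfolding S by (simp add: emeasure_lborel_cbox_eq)
  moreover have "mv_list N e (vs @ us) K = d * mv_list N e bs K"
    using d(3)[rule_format, OF linear_id] by (simp add: map_T)
  ultimately show ?thesis
    using d(1) by blast
qed

section \<open>Hausdorff measure and Lebesgue measure\<close>

text \<open>Both the Hausdorff measure and the volume of the slab over a set are invariant under
  translations by the span of X. As in the uniqueness proof for Haar measure, Fubini shows that they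
  are proportional, with the unit cube as reference set.\<close>

lemma hausdorff_slab:
  fixes p :: "'a::euclidean_space \<Rightarrow> 'a"
  assumes X: "orthonormal X" "card X = q"
    and p: "linear p" "\<And>x. p x \<in> span X" "\<And>x. x \<in> span X \<Longrightarrow> p x = x"
    and C [measurable]: "C \<in> sets borel" and CX: "C \<subseteq> span X"
    and R [measurable]: "R \<in> sets borel"
  shows "emeasure (hausdorff q) C * emeasure lborel {y. p y \<in> unit_cube X \<and> y - p y \<in> R} =
    hausdorff_outer q (unit_cube X) * emeasure lborel {y. p y \<in> C \<and> y - p y \<in> R}"
proof -
  define K where "K = unit_cube X"
  define M where "M = span X"
  have [measurable]: "p \<in> borel_measurable borel"
    by (rule borel_measurable_linear[OF p(1)])
  have [measurable]: "K \<in> sets borel" "M \<in> sets borel"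
    unfolding K_def M_def by (intro borel_closed closed_unit_cube closed_subspace subspace_span)+
  have KM: "K \<subseteq> M"
    by (auto simp: K_def M_def unit_cube_def)
  \<comment> \<open>The Hausdorff measure of the whole space need not be sigma-finite. Its
    restriction to M is, which makes Fubini available, and as a density it still lives on the whole
    space.\<close>
  define \<mu> where "\<mu> = density (hausdorff q) (indicator M)"
  have sets_\<mu> [measurable_cong, simp]: "sets \<mu> = sets borel"
    by (simp add: \<mu>_def)
  have space_\<mu> [simp]: "space \<mu> = UNIV"
    by (simp add: \<mu>_def)
  have em: "emeasure \<mu> A = hausdorff_outer q (M \<inter> A)" if [measurable]: "A \<in> sets borel" for A
  proof -
    have "emeasure \<mu> A = (\<integral>\<^sup>+x. indicator M x * indicator A x \<partial>hausdorff q)"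
      unfolding \<mu>_def by (rule emeasure_density) (auto intro!: borel_measurable_indicator)
    also have "\<dots> = (\<integral>\<^sup>+x. indicator (M \<inter> A) x \<partial>hausdorff q)"
      by (simp add: indicator_inter_arith)
    also have "\<dots> = emeasure (hausdorff q) (M \<inter> A)"
      by (rule nn_integral_indicator) simp
    also have "\<dots> = hausdorff_outer q (M \<inter> A)"
      by (rule emeasure_hausdorff) simp
    finally show ?thesis .
  qed
  have M_add: "a + x \<in> M \<longleftrightarrow> x \<in> M" if "a \<in> M" for a x
    using that span_add_eq[of a X x] by (simp add: M_def)
  have image_plus: "hausdorff_outer q ((+) a ` A) = hausdorff_outer q A" for a :: 'a and A
    by (rule hausdorff_outer_isometry) simp
  have image_minus: "hausdorff_outer q (uminus ` A) = hausdorff_outer q A" for A :: "'a set"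
    by (rule hausdorff_outer_isometry) (simp add: dist_minus)
  have translate: "(\<integral>\<^sup>+x. h (x + a) \<partial>\<mu>) = (\<integral>\<^sup>+x. h x \<partial>\<mu>)"
    if a: "a \<in> M" and [measurable]: "h \<in> borel_measurable borel" for h and a
  proof -
    have "distr \<mu> borel ((+) a) = \<mu>"
    proof (rule measure_eqI)
      fix A assume "A \<in> sets (distr \<mu> borel ((+) a))"
      hence [measurable]: "A \<in> sets borel" by simp
      have "emeasure (distr \<mu> borel ((+) a)) A = emeasure \<mu> ((+) a -` A)"
        by (subst emeasure_distr) simp_all
      also have "\<dots> = hausdorff_outer q (M \<inter> (+) a -` A)"
        by (rule em) (use measurable_sets[of "(+) a" borel borel A] in simp)
      also have "\<dots> = hausdorff_outer q ((+) a ` (M \<inter> (+) a -` A))"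
        by (simp only: image_plus)
      also have "(+) a ` (M \<inter> (+) a -` A) = M \<inter> A"
      proof (intro equalityI subsetI)
        fix x assume "x \<in> M \<inter> A"
        thus "x \<in> (+) a ` (M \<inter> (+) a -` A)"
          using M_add[OF a, of "x - a"] by (intro image_eqI[of _ _ "x - a"]) auto
      qed (use M_add[OF a] in auto)
      finally show "emeasure (distr \<mu> borel ((+) a)) A = emeasure \<mu> A"
        by (simp add: em)
    qed simp
    hence "(\<integral>\<^sup>+x. h x \<partial>\<mu>) = (\<integral>\<^sup>+x. h x \<partial>distr \<mu> borel ((+) a))"
      by simp
    also have "\<dots> = (\<integral>\<^sup>+x. h (x + a) \<partial>\<mu>)"
      by (subst nn_integral_distr) (simp_all add: add.commute)
    finally show ?thesis ..
  qed
  have AE_M: "AE x in \<mu>. x \<in> M"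
    unfolding \<mu>_def by (subst AE_density) (auto simp: indicator_def intro!: borel_measurable_indicator)
  have fin: "finite X"
    by (rule orthonormal_finite[OF X(1)])
  interpret sigma_finite_measure \<mu>
  proof
    define z where "z n = (\<Sum>u\<in>X. real_of_int (n u) *\<^sub>R u)" for n
    \<comment> \<open>The integer translates of the unit cube cover M, and the complement of M is a
      null set.\<close>
    let ?A = "insert (- M) ((\<lambda>n. (+) (z n) ` K) ` (X \<rightarrow>\<^sub>E UNIV))"
    have zM: "z n \<in> M" for n
      unfolding z_def M_def by (intro span_sum span_scale span_base)
    have [measurable]: "(+) (z n) ` K \<in> sets borel" for n
      using closed_unit_cube[of X] unfolding K_def by (intro borel_closed closed_translation)
    have "countable ?A"
      by (intro countable_insert countable_image countable_PiE fin) simp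
    moreover have "M \<subseteq> \<Union> ?A"
    proof
      fix x assume x: "x \<in> M"
      define n where "n = restrict (\<lambda>u. \<lfloor>x \<bullet> u\<rfloor>) X"
      have "z n \<bullet> u = \<lfloor>x \<bullet> u\<rfloor>" if "u \<in> X" for u
        unfolding z_def using orthonormal_inner_sum[OF X(1) that] that by (simp add: n_def)
      hence "0 \<le> (x - z n) \<bullet> u \<and> (x - z n) \<bullet> u \<le> 1" if "u \<in> X" for u
        using that by (simp add: inner_diff_left) linarith
      hence "x - z n \<in> K"
        using x zM[of n] by (simp add: K_def unit_cube_def M_def span_diff)
      hence "x \<in> (+) (z n) ` K"
        by (intro image_eqI[of _ _ "x - z n"]) auto
      moreover have "n \<in> X \<rightarrow>\<^sub>E UNIV"
        by (auto simp: n_def)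
      ultimately show "x \<in> \<Union> ?A" by blast
    qed
    hence "\<Union> ?A = UNIV" by auto
    moreover have "emeasure \<mu> A \<noteq> \<infinity>" if "A \<in> ?A" for A
    proof -
      have "emeasure \<mu> (- M) = 0"
        by (simp add: em hausdorff_outer_empty)
      moreover have "emeasure \<mu> ((+) (z n) ` K) \<noteq> \<infinity>" for n
      proof -
        have "emeasure \<mu> ((+) (z n) ` K) \<le> hausdorff_outer q ((+) (z n) ` K)"
          by (simp add: em hausdorff_outer_mono)
        also have "\<dots> < \<infinity>"
          unfolding image_plus K_def by (rule hausdorff_outer_unit_cube_finite[OF X])
        finally show ?thesis by simp
      qed
      ultimately show ?thesis using that by auto
    qed
    ultimately show "\<exists>A. countable A \<and> A \<subseteq> sets \<mu> \<and> \<Union> A = space \<mu> \<and> (\<forall>a\<in>A. emeasure \<mu> a \<noteq> \<infinity>)"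
      by (intro exI[of _ ?A]) auto
  qed
  interpret P: pair_sigma_finite \<mu> lborel
    by standard
  define c :: "'a \<Rightarrow> ennreal" where "c = indicator C"
  define k :: "'a \<Rightarrow> ennreal" where "k = indicator K"
  define r :: "'a \<Rightarrow> ennreal" where "r = indicator R"
  have [measurable]: "c \<in> borel_measurable borel" "k \<in> borel_measurable borel" "r \<in> borel_measurable borel"
    by (simp_all add: c_def k_def r_def)
  have slab: "(\<integral>\<^sup>+y. indicator A (p y) * r (y - p y) \<partial>lborel) = emeasure lborel {y. p y \<in> A \<and> y - p y \<in> R}"
    if [measurable]: "A \<in> sets borel" for A
  proof -
    have "{y. p y \<in> A \<and> y - p y \<in> R} \<in> sets lborel"
      by measurable
    hence "emeasure lborel {y. p y \<in> A \<and> y - p y \<in> R} =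
        (\<integral>\<^sup>+y. indicator {y. p y \<in> A \<and> y - p y \<in> R} y \<partial>lborel)"
      by (rule nn_integral_indicator[symmetric])
    also have "\<dots> = (\<integral>\<^sup>+y. indicator A (p y) * r (y - p y) \<partial>lborel)"
      by (intro nn_integral_cong) (simp add: indicator_def r_def)
    finally show ?thesis ..
  qed
  have c_int: "(\<integral>\<^sup>+x. c x \<partial>\<mu>) = emeasure (hausdorff q) C"
  proof -
    have "M \<inter> C = C" using CX by (auto simp: M_def)
    thus ?thesis by (simp add: c_def em emeasure_hausdorff)
  qed
  have k_int: "(\<integral>\<^sup>+x. k (- x) \<partial>\<mu>) = hausdorff_outer q K"
  proof -
    have "(\<integral>\<^sup>+x. k (- x) \<partial>\<mu>) = (\<integral>\<^sup>+x. indicator (uminus ` K) x \<partial>\<mu>)"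
      by (intro nn_integral_cong) (auto simp: k_def indicator_def intro: image_eqI[of _ uminus "- _"])
    also have "\<dots> = emeasure \<mu> (uminus ` K)"
      using closed_negations[OF closed_unit_cube[of X]] by (intro nn_integral_indicator) (simp add: K_def)
    also have "\<dots> = hausdorff_outer q (M \<inter> uminus ` K)"
      using closed_negations[OF closed_unit_cube[of X]] by (intro em) (simp add: K_def)
    also have "M \<inter> uminus ` K = uminus ` K"
      using KM by (auto simp: M_def span_neg)
    finally show ?thesis
      by (simp add: image_minus)
  qed
  have p_simps: "p (x + y) = p x + p y" "p (x - y) = p x - p y" "p (- x) = - p x" "p (p x) = p x" for x y
    using p by (simp_all add: linear_add linear_diff linear_neg)
  have "emeasure (hausdorff q) C * emeasure lborel {y. p y \<in> K \<and> y - p y \<in> R} =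
      (\<integral>\<^sup>+x. \<integral>\<^sup>+y. c x * (k (p y) * r (y - p y)) \<partial>lborel \<partial>\<mu>)"
    by (simp add: nn_integral_cmult nn_integral_multc c_int slab[symmetric] k_def)
  \<comment> \<open>Here y moves by -x, then x by \<open>p y\<close>, which lies in M, and finally y
    by x. The net effect exchanges the roles of c and k, with k reflected.\<close>
  also have "\<dots> = (\<integral>\<^sup>+x. \<integral>\<^sup>+y. c x * (k (p (y + - x)) * r (y + - x - p (y + - x))) \<partial>lborel \<partial>\<mu>)"
    by (rule nn_integral_cong, rule nn_integral_lborel_translate[symmetric]) measurable
  also have "\<dots> = (\<integral>\<^sup>+y. \<integral>\<^sup>+x. c x * (k (p (y + - x)) * r (y + - x - p (y + - x))) \<partial>\<mu> \<partial>lborel)"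
    by (rule P.Fubini'[symmetric]) measurable
  also have "\<dots> = (\<integral>\<^sup>+y. \<integral>\<^sup>+x. c (x + p y) * (k (p (y + - (x + p y))) * r (y + - (x + p y) - p (y + - (x + p y)))) \<partial>\<mu> \<partial>lborel)"
    by (rule nn_integral_cong, rule translate[symmetric], use p(2) in \<open>simp add: M_def\<close>) measurable
  also have "\<dots> = (\<integral>\<^sup>+x. \<integral>\<^sup>+y. c (x + p y) * (k (p (y + - (x + p y))) * r (y + - (x + p y) - p (y + - (x + p y)))) \<partial>lborel \<partial>\<mu>)"
    by (rule P.Fubini') measurable
  also have "\<dots> = (\<integral>\<^sup>+x. \<integral>\<^sup>+y. k (- x) * (c (p (y + x)) * r (y + x - p (y + x))) \<partial>lborel \<partial>\<mu>)"
  \<comment> \<open>The identity \<open>p x = x\<close> holds on M only, but M carries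
    \<open>\<mu>\<close>.\<close>
  proof (rule nn_integral_cong_AE, rule AE_mp[OF AE_M], intro AE_I2 impI nn_integral_cong)
    fix x y assume "x \<in> M"
    hence "p x = x" by (simp add: M_def p(3))
    thus "c (x + p y) * (k (p (y + - (x + p y))) * r (y + - (x + p y) - p (y + - (x + p y)))) =
        k (- x) * (c (p (y + x)) * r (y + x - p (y + x)))"
      by (simp add: p_simps algebra_simps)
  qed
  also have "\<dots> = (\<integral>\<^sup>+x. \<integral>\<^sup>+y. k (- x) * (c (p y) * r (y - p y)) \<partial>lborel \<partial>\<mu>)"
  proof (rule nn_integral_cong)
    fix x
    show "(\<integral>\<^sup>+y. k (- x) * (c (p (y + x)) * r (y + x - p (y + x))) \<partial>lborel) =
        (\<integral>\<^sup>+y. k (- x) * (c (p y) * r (y - p y)) \<partial>lborel)"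
      by (rule nn_integral_lborel_translate[of "\<lambda>y. k (- x) * (c (p y) * r (y - p y))"]) measurable
  qed
  also have "\<dots> = hausdorff_outer q K * emeasure lborel {y. p y \<in> C \<and> y - p y \<in> R}"
    by (simp add: nn_integral_cmult nn_integral_multc k_int slab[symmetric] c_def)
  finally show ?thesis
    by (simp add: K_def)
qed

section \<open>Projections in the Heisenberg group\<close>

lemma direct_sum_projection:
  fixes W V :: "'a::real_vector set"
  assumes W: "subspace W" and V: "subspace V" and "W \<inter> V = {0}"
    and sum: "\<And>x. \<exists>w\<in>W. \<exists>v\<in>V. x = w + v"
  obtains p where "linear p" "\<And>x. p x \<in> V" "\<And>x. x - p x \<in> W"
    "\<And>x. x \<in> V \<Longrightarrow> p x = x" "\<And>x. x \<in> W \<Longrightarrow> p x = 0"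
proof -
  have "\<exists>v\<in>V. x - v \<in> W" for x
    using sum[of x] by (metis add_diff_cancel_right')
  then obtain p where p: "\<And>x. p x \<in> V" "\<And>x. x - p x \<in> W"
    by metis
  have uniq: "p x = v" if "v \<in> V" "x - v \<in> W" for x v
  proof -
    have "(x - v) - (x - p x) \<in> W" "p x - v \<in> V"
      using that p subspace_diff[OF W] subspace_diff[OF V] by blast+
    hence "p x - v \<in> W \<inter> V" by simp
    thus ?thesis using assms(3) by simp
  qed
  have "linear p"
  proof (rule linearI)
    fix x y c
    show "p (x + y) = p x + p y"
      using subspace_add[OF V p(1) p(1), of x y] subspace_add[OF W p(2) p(2), of x y]
      by (intro uniq) (simp_all add: algebra_simps)
    show "p (c *\<^sub>R x) = c *\<^sub>R p x"
      using subspace_scale[OF V p(1), of c x] subspace_scale[OF W p(2), of c x]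
      by (intro uniq) (simp_all add: algebra_simps)
  qed
  moreover have "p x = x" if "x \<in> V" for x
    using that subspace_0[OF W] by (intro uniq) simp_all
  moreover have "p x = 0" if "x \<in> W" for x
    using that subspace_0[OF V] by (intro uniq) simp_all
  ultimately show ?thesis
    using p that by blast
qed

lemma bilinear_hbracket:
  assumes H: "heisenberg n H"
  shows "bilinear (hbracket H)"
proof -
  have bil: "symp H (a *\<^sub>R x + b *\<^sub>R y) z = a * symp H x z + b * symp H y z"
    "symp H z (a *\<^sub>R x + b *\<^sub>R y) = a * symp H z x + b * symp H z y"
    if "x \<in> layer1 H" "y \<in> layer1 H" "z \<in> layer1 H" for x y z a b
    using heisenbergD(5)[OF H] that unfolding symplectic_on_def by blast+
  show ?thesis
    unfolding bilinear_def
  proof (intro conjI allI linearI)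
    fix x y z :: 'a and c :: real
    note l = proj1_props(1)[OF H]
    show "hbracket H z (x + y) = hbracket H z x + hbracket H z y"
      using bil(2)[OF l[of x] l[of y] l[of z], of 1 1]
      by (simp add: hbracket_def proj1_linear[OF H] scaleR_left_distrib)
    show "hbracket H z (c *\<^sub>R x) = c *\<^sub>R hbracket H z x"
      using bil(2)[OF l[of x] l[of x] l[of z], of c 0]
      by (simp add: hbracket_def proj1_linear[OF H])
    show "hbracket H (x + y) z = hbracket H x z + hbracket H y z"
      using bil(1)[OF l[of x] l[of y] l[of z], of 1 1]
      by (simp add: hbracket_def proj1_linear[OF H] scaleR_left_distrib)
    show "hbracket H (c *\<^sub>R x) z = c *\<^sub>R hbracket H x z"
      using bil(1)[OF l[of x] l[of x] l[of z], of c 0]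
      by (simp add: hbracket_def proj1_linear[OF H])
  qed
qed

lemma hbracket_self: "heisenberg n H \<Longrightarrow> hbracket H x x = 0"
  by (simp add: hbracket_def symp_simps(1) proj1_props(1))

lemma hbracket_layer2_left:
  assumes "heisenberg n H" "x \<in> layer2 H"
  shows "hbracket H x y = 0"
  using symp_simps(5)[OF assms(1) proj1_props(1)[OF assms(1)], of y]
  by (simp add: hbracket_def proj1_layer2[OF assms])

lemma hbracket_mem_vertical:
  assumes "heisenberg n H" "vertical_subgroup H W"
  shows "hbracket H x y \<in> W"
  using assms(2) hbracket_layer2[OF assms(1), of x y] by (auto simp: vertical_subgroup_def)

text \<open>The bracket term of a group product lies in the second layer, hence in W, and is
  absorbed by the first summand.\<close>

lemma semidirect_linear_sum:
  assumes H: "heisenberg n H" and WV: "semidirect H W V"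
  shows "\<exists>w\<in>W. \<exists>v\<in>V. x = w + v"
proof -
  have W: "vertical_subgroup H W" and "W <#>\<^bsub>hgroup H\<^esub> V = UNIV"
    using WV by (auto simp: semidirect_def)
  hence "x \<in> W <#>\<^bsub>hgroup H\<^esub> V" by blast
  then obtain w v where wv: "w \<in> W" "v \<in> V" "x = w \<otimes>\<^bsub>hgroup H\<^esub> v"
    by (auto simp: set_mult_def)
  have sub: "subspace W"
    by (rule vertical_subspace[OF H W])
  have "w + (1/2) *\<^sub>R hbracket H w v \<in> W"
    by (intro subspace_add subspace_scale sub wv(1) hbracket_mem_vertical[OF H W])
  thus ?thesis
    using wv by (intro bexI[of _ "w + (1/2) *\<^sub>R hbracket H w v"] bexI[of _ v])
      (simp_all add: mult_hgroup)
qed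

text \<open>Let x be the group product of w and v. The bracket lies in W, so the linear projection
  gives p x = v. Moreover [w, v] = [x, v], since [v, v] and brackets with the second layer vanish,
  and the product can be solved for w.\<close>

lemma vproj_eq:
  assumes H: "heisenberg n H" and W: "vertical_subgroup H W"
    and p: "linear p" "\<And>x. p x \<in> V" "\<And>x. x - p x \<in> W"
      "\<And>x. x \<in> V \<Longrightarrow> p x = x" "\<And>x. x \<in> W \<Longrightarrow> p x = 0"
  shows "vproj H W V x = x - p x - (1/2) *\<^sub>R hbracket H x (p x)"
  unfolding vproj_def
proof (rule the_equality)
  note bil = bilinear_hbracket[OF H]
  have sub: "subspace W"
    by (rule vertical_subspace[OF H W])
  note L2 = hbracket_mem_vertical[OF H W]
  have br: "hbracket H (c *\<^sub>R hbracket H y z) v = 0" for c y z v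
    by (intro hbracket_layer2_left[OF H] subspace_scale heisenbergD[OF H] hbracket_layer2[OF H])
  let ?w = "x - p x - (1/2) *\<^sub>R hbracket H x (p x)"
  have "?w \<in> W"
    using subspace_diff[OF sub p(3)[of x] subspace_scale[OF sub L2]] .
  moreover have "x = ?w \<otimes>\<^bsub>hgroup H\<^esub> p x"
    by (simp add: mult_hgroup bilinear_lsub[OF bil] br hbracket_self[OF H])
  ultimately show "?w \<in> W \<and> (\<exists>v\<in>V. x = ?w \<otimes>\<^bsub>hgroup H\<^esub> v)"
    using p(2) by blast
next
  note bil = bilinear_hbracket[OF H]
  have br: "hbracket H (c *\<^sub>R hbracket H y z) v = 0" for c y z v
    by (intro hbracket_layer2_left[OF H] subspace_scale heisenbergD[OF H] hbracket_layer2[OF H])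
  fix w assume "w \<in> W \<and> (\<exists>v\<in>V. x = w \<otimes>\<^bsub>hgroup H\<^esub> v)"
  then obtain v where wv: "w \<in> W" "v \<in> V" and x: "x = w + v + (1/2) *\<^sub>R hbracket H w v"
    by (auto simp: mult_hgroup)
  have "p x = v"
    using wv by (simp add: x linear_add[OF p(1)] linear_cmul[OF p(1)] p(4,5) hbracket_mem_vertical[OF H W])
  moreover have "hbracket H x v = hbracket H w v"
    unfolding x by (simp add: bilinear_ladd[OF bil] br hbracket_self[OF H])
  ultimately show "w = x - p x - (1/2) *\<^sub>R hbracket H x (p x)"
    by (simp add: x)
qed

lemma dim_layers_heisenberg:
  assumes "heisenberg n H"
  shows "dim (layer1 H) = 2 * n" "dim (layer2 H) = 1"
  using assms unfolding heisenberg_def by - (elim conjE, assumption)+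

lemma DIM_heisenberg:
  fixes H :: "'a::euclidean_space heis"
  assumes "heisenberg n H"
  shows "DIM('a) = 2 * n + 1"
proof -
  have "dim {u + w | u w. u \<in> layer1 H \<and> w \<in> layer2 H} + dim (layer1 H \<inter> layer2 H) =
      dim (layer1 H) + dim (layer2 H)"
    by (rule dim_sums_Int[OF heisenbergD(1,2)[OF assms]])
  thus ?thesis
    by (simp only: heisenbergD(3,4)[OF assms] dim_layers_heisenberg[OF assms] dim_UNIV)
      simp
qed

lemma borel_measurable_hbracket:
  assumes H: "heisenberg n H" and f: "f \<in> borel_measurable N" "g \<in> borel_measurable N"
  shows "(\<lambda>x. hbracket H (f x) (g x)) \<in> borel_measurable N"
proof -
  have "bounded_bilinear (hbracket H)"
    by (rule bilinear_conv_bounded_bilinear[THEN iffD1, OF bilinear_hbracket[OF H]])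
  note cont = bounded_bilinear.continuous_on[OF this continuous_on_fst[OF continuous_on_id]
      continuous_on_snd[OF continuous_on_id]]
  have "(\<lambda>q. hbracket H (fst q) (snd q)) \<in> borel_measurable (borel \<Otimes>\<^sub>M borel)"
    unfolding borel_prod by (rule borel_measurable_continuous_onI) (rule cont)
  from measurable_compose[OF measurable_Pair[OF f] this] show ?thesis
    by (simp only: fst_conv snd_conv)
qed

text \<open>The projection w of m differs from m by -a m and a term in the second layer. Hence b w =
  -a m and [w, b w] = -[m, a m], so projecting back restores exactly what was subtracted. Exchanging
  the two subgroups gives the other composition.\<close>

lemma vproj_inverse:
  assumes H: "heisenberg n H" and M: "vertical_subgroup H M" and W: "vertical_subgroup H W"
    and a: "linear a" "\<And>x. a x \<in> V" "\<And>x. x - a x \<in> W"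
      "\<And>x. x \<in> V \<Longrightarrow> a x = x" "\<And>x. x \<in> W \<Longrightarrow> a x = 0"
    and b: "linear b" "\<And>x. b x \<in> V" "\<And>x. x - b x \<in> M"
      "\<And>x. x \<in> V \<Longrightarrow> b x = x" "\<And>x. x \<in> M \<Longrightarrow> b x = 0"
    and m: "m \<in> M"
  shows "vproj H M V (vproj H W V m) = m"
proof -
  note bil = bilinear_hbracket[OF H]
  have br: "hbracket H (c *\<^sub>R hbracket H y z) v = 0" for c y z v
    by (intro hbracket_layer2_left[OF H] subspace_scale heisenbergD[OF H] hbracket_layer2[OF H])
  have b0: "b (c *\<^sub>R hbracket H y z) = 0" for c y z
    by (simp add: linear_cmul[OF b(1)] b(5)[OF hbracket_mem_vertical[OF H M]])
  define w where "w = vproj H W V m"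
  have w: "w = m - a m - (1/2) *\<^sub>R hbracket H m (a m)"
    unfolding w_def by (rule vproj_eq[OF H W a])
  have "b w = - a m"
    unfolding w by (simp add: linear_diff[OF b(1)] b0 b(4)[OF a(2)] b(5)[OF m])
  moreover have "hbracket H w (- a m) = - hbracket H m (a m)"
    unfolding w by (simp add: bilinear_lsub[OF bil] bilinear_rneg[OF bil] br hbracket_self[OF H])
  ultimately have "vproj H M V w = m"
    by (simp add: vproj_eq[OF H M b] w)
  thus ?thesis by (simp add: w_def)
qed

lemma vproj_mem:
  assumes H: "heisenberg n H" and W: "vertical_subgroup H W"
    and a: "linear a" "\<And>x. a x \<in> V" "\<And>x. x - a x \<in> W"
      "\<And>x. x \<in> V \<Longrightarrow> a x = x" "\<And>x. x \<in> W \<Longrightarrow> a x = 0"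
  shows "vproj H W V x \<in> W"
proof -
  have "x - a x - (1/2) *\<^sub>R hbracket H x (a x) \<in> W"
    by (intro subspace_diff subspace_scale vertical_subspace[OF H W] a(3) hbracket_mem_vertical[OF H W])
  thus ?thesis
    by (simp only: vproj_eq[OF H W a])
qed

lemma emeasure_lborel_vproj_slab:
  assumes H: "heisenberg n H" and M: "vertical_subgroup H M" and W: "vertical_subgroup H W"
    and a: "linear a" "\<And>x. a x \<in> V" "\<And>x. x - a x \<in> W"
      "\<And>x. x \<in> V \<Longrightarrow> a x = x" "\<And>x. x \<in> W \<Longrightarrow> a x = 0"
    and b: "linear b" "\<And>x. b x \<in> V" "\<And>x. x - b x \<in> M"
      "\<And>x. x \<in> V \<Longrightarrow> b x = x" "\<And>x. x \<in> M \<Longrightarrow> b x = 0"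
    and norm: "norm (vert H) = 1"
    and BM: "B \<subseteq> M" and PB: "vproj H W V ` B \<in> sets borel" and R: "R \<in> sets borel"
  shows "emeasure lborel {y. y - a y \<in> vproj H W V ` B \<and> a y \<in> R} =
    emeasure lborel {y. y - b y \<in> B \<and> b y \<in> R}"
proof -
  note bil = bilinear_hbracket[OF H]
  let ?e = "vert H"
  have [measurable]: "a \<in> borel_measurable borel" "b \<in> borel_measurable borel"
    using a(1) b(1) by (simp_all add: borel_measurable_linear)
  have eL: "c *\<^sub>R ?e \<in> layer2 H" for c
    using heisenbergD[OF H] by (simp add: subspace_scale)
  have ae: "a (c *\<^sub>R ?e) = 0" and be: "b (c *\<^sub>R ?e) = 0" for c
    using eL[of c] M W by (auto intro!: a(5) b(5) simp: vertical_subgroup_def)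
  have bb: "b (b x) = b x" for x
    by (rule b(4)[OF b(2)])
  have ee: "?e \<bullet> ?e = 1"
    using norm by (simp add: norm_eq_1)
  let ?P = "vproj H W V"
  have P: "?P x = x - a x - (1/2) *\<^sub>R hbracket H x (a x)" for x
    by (rule vproj_eq[OF H W a])
  \<comment> \<open>With m = x - b x, the component of x in M, this is
    \<open>vproj H W V m - m\<close>. So x + g x projects m and keeps the component b x in
    V.\<close>
  define g where "g x = - a (x - b x) - (1/2) *\<^sub>R hbracket H (x - b x) (a (x - b x))" for x
  \<comment> \<open>This linear map fixes V and the vector \<open>vert H\<close>, and takes its
    values in their sum, which contains all values of g.\<close>
  define p where "p x = b x + ((x - b x) \<bullet> ?e) *\<^sub>R ?e" for x
  have p_b: "p y - b (p y) = ((y - b y) \<bullet> ?e) *\<^sub>R ?e" for y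
    by (simp add: p_def linear_add[OF b(1)] be bb)
  have "{x. x + g x \<in> {y. y - a y \<in> ?P ` B \<and> a y \<in> R}} = {y. y - b y \<in> B \<and> b y \<in> R}"
  proof -
    have "x + g x - a (x + g x) \<in> ?P ` B \<longleftrightarrow> x - b x \<in> B"
      and ax: "a (x + g x) = b x" for x
    proof -
      define m where "m = x - b x"
      have m: "m \<in> M" unfolding m_def by (rule b(3))
      have x: "x + g x = ?P m + b x"
        by (simp add: P g_def m_def[symmetric]) (simp add: m_def)
      have aP: "a (?P m) = 0"
        by (intro a(5) vproj_mem[OF H W a])
      show "a (x + g x) = b x"
        by (simp add: x linear_add[OF a(1)] aP a(4)[OF b(2)])
      hence "x + g x - a (x + g x) = ?P m"
        by (simp add: x)
      moreover have "?P m \<in> ?P ` B \<longleftrightarrow> m \<in> B"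
      proof
        assume "?P m \<in> ?P ` B"
        then obtain m' where "m' \<in> B" "?P m = ?P m'" by blast
        thus "m \<in> B"
          using vproj_inverse[OF H M W a b m] vproj_inverse[OF H M W a b, of m'] BM by auto
      qed simp
      ultimately show "x + g x - a (x + g x) \<in> ?P ` B \<longleftrightarrow> x - b x \<in> B"
        by (simp add: m_def)
    qed
    thus ?thesis by auto
  qed
  moreover have "emeasure lborel {x. x + g x \<in> {y. y - a y \<in> ?P ` B \<and> a y \<in> R}} =
      emeasure lborel {y. y - a y \<in> ?P ` B \<and> a y \<in> R}"
  proof (rule emeasure_lborel_shear[of p])
    show "linear p"
      by (rule linearI)
        (simp_all add: p_def linear_add[OF b(1)] linear_cmul[OF b(1)] algebra_simps inner_add_left inner_diff_left)
    note [measurable] = borel_measurable_hbracket[OF H]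
    show "g \<in> borel_measurable borel"
      unfolding g_def by measurable
    show "{y. y - a y \<in> ?P ` B \<and> a y \<in> R} \<in> sets borel"
    proof -
      note [measurable] = PB R
      have "{y \<in> space borel. y - a y \<in> ?P ` B \<and> a y \<in> R} \<in> sets borel"
        by measurable
      thus ?thesis by simp
    qed
    fix x y
    let ?m = "x - b x"
    have "hbracket H ?m (a ?m) = symp H (proj1 H ?m) (proj1 H (a ?m)) *\<^sub>R ?e"
      by (simp add: hbracket_def)
    then obtain s where s: "(1/2) *\<^sub>R hbracket H ?m (a ?m) = s *\<^sub>R ?e"
      by (metis scaleR_scaleR)
    have "g x = - a ?m - s *\<^sub>R ?e"
      by (simp add: g_def s[symmetric])
    moreover have "b (- a ?m) = - a ?m"
      by (simp add: linear_neg[OF b(1)] b(4)[OF a(2)])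
    ultimately show "p (g x) = g x"
      by (simp add: p_def linear_diff[OF b(1)] be ee)
    \<comment> \<open>Adding \<open>p y\<close> changes the component in M only by a multiple of
      \<open>vert H\<close>, which both \<open>a\<close> and the bracket annihilate.\<close>
    have eq: "x + p y - b (x + p y) = ?m + ((y - b y) \<bullet> ?e) *\<^sub>R ?e"
      using p_b[of y] by (simp add: linear_add[OF b(1)] algebra_simps)
    show "g (x + p y) = g x"
      unfolding g_def eq
      by (simp add: linear_add[OF a(1)] ae bilinear_ladd[OF bil] hbracket_layer2_left[OF H eL])
  qed
  ultimately show ?thesis by simp
qed

section \<open>Comparison of the slabs over a Borel set and over its projection\<close>

theorem lemma3p1:
  fixes H :: "'a::euclidean_space heis"
    and e :: "nat \<Rightarrow> 'a" and n k :: nat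
    and M W V B :: "'a set"
    and vs ws ms :: "'a list"
  assumes "heisenberg n H" and "heisenberg_basis n H e"
    and "vertical_subgroup H M" and "vertical_subgroup H W"
    and "horizontal_subgroup H V" and "dim V = k"
    and "semidirect H M V" and "semidirect H W V"
    and "length vs = k" and "orthonormal_basis_list vs V"
    and "length ws = 2 * n - k" and "orthonormal_basis_list (ws @ [e (2 * n + 1)]) W"
    and "length ms = 2 * n - k" and "orthonormal_basis_list (ms @ [e (2 * n + 1)]) M"
    and "B \<in> sets borel" and "B \<subseteq> M"
  shows "emeasure
           (distr (restrict_space (hausdorff (2 * n + 1 - k)) W) (restrict_space borel M)
              (vproj H M V)) B
         = emeasure (hausdorff (2 * n + 1 - k)) (vproj H W V ` B)
       \<and> emeasure (hausdorff (2 * n + 1 - k)) (vproj H W V ` B)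
         = ennreal
             (mv_norm (2 * n + 1)
                (mv_list (2 * n + 1) e vs \<and>\<^sub>m mv_list (2 * n + 1) e (ms @ [e (2 * n + 1)]))
              / mv_norm (2 * n + 1)
                (mv_list (2 * n + 1) e vs \<and>\<^sub>m mv_list (2 * n + 1) e (ws @ [e (2 * n + 1)])))
           * emeasure (hausdorff (2 * n + 1 - k)) B"
proof -
  note H = assms(1) and M = assms(3) and W = assms(4)
  define N where "N = 2 * n + 1"
  define q where "q = 2 * n + 1 - k"
  have DIM: "DIM('a) = N"
    unfolding N_def by (rule DIM_heisenberg[OF H])
  have e_inner: "e i \<bullet> e j = of_bool (i = j)" if "i \<in> {1..N}" "j \<in> {1..N}" for i j
    using assms(2) that unfolding heisenberg_basis_def N_def by blast
  have eN: "e N = vert H"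
    using assms(2) by (simp add: heisenberg_basis_def N_def)
  have norm: "norm (vert H) = 1"
    using e_inner[of N N] by (simp add: eN[symmetric] norm_eq_1 N_def)
  have subV: "subspace V"
    by (rule horizontal_subspace[OF H assms(5)])
  \<comment> \<open>This makes the natural-number subtractions 2n - k and 2n + 1 - k exact.\<close>
  have k: "k \<le> 2 * n"
  proof -
    have "V \<subseteq> layer1 H"
      using assms(5) by (simp add: horizontal_subgroup_def)
    hence "dim V \<le> dim (layer1 H)"
      by (rule dim_subset)
    thus ?thesis
      using dim_layers_heisenberg(1)[OF H] assms(6) by simp
  qed
  note vs = orthonormal_basis_listD[OF assms(10)]
  note ws = orthonormal_basis_listD[OF assms(12)]
  note ms = orthonormal_basis_listD[OF assms(14)]
  have card: "card (set (ws @ [e (2 * n + 1)])) = q" "card (set (ms @ [e (2 * n + 1)])) = q"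
    using distinct_card[OF ws(2)] distinct_card[OF ms(2)] assms(11,13) k by (simp_all add: q_def)
  have int: "M \<inter> V = {0}" "W \<inter> V = {0}"
    using assms(7,8) by (auto simp: semidirect_def)
  obtain a where a: "linear a" "\<And>x. a x \<in> V" "\<And>x. x - a x \<in> W"
      "\<And>x. x \<in> V \<Longrightarrow> a x = x" "\<And>x. x \<in> W \<Longrightarrow> a x = 0"
    by (rule direct_sum_projection[OF vertical_subspace[OF H W] subV int(2) semidirect_linear_sum[OF H assms(8)]])
      blast
  obtain b where b: "linear b" "\<And>x. b x \<in> V" "\<And>x. x - b x \<in> M"
      "\<And>x. x \<in> V \<Longrightarrow> b x = x" "\<And>x. x \<in> M \<Longrightarrow> b x = 0"
    by (rule direct_sum_projection[OF vertical_subspace[OF H M] subV int(1) semidirect_linear_sum[OF H assms(7)]])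
      blast
  have P_M: "vproj H M V = (\<lambda>x. x - b x - (1/2) *\<^sub>R hbracket H x (b x))"
    by (rule ext) (rule vproj_eq[OF H M b])
  have [measurable]: "a \<in> borel_measurable borel" "b \<in> borel_measurable borel"
    using a(1) b(1) by (simp_all add: borel_measurable_linear)
  note [measurable] = borel_measurable_hbracket[OF H]
  have P_M_meas [measurable]: "vproj H M V \<in> borel_measurable borel"
    unfolding P_M by measurable
  have closed: "closed W" "closed M"
    using closed_subspace vertical_subspace[OF H] W M by auto
  hence [measurable]: "W \<in> sets borel" "M \<in> sets borel"
    by auto
  note [measurable] = \<open>B \<in> sets borel\<close>
  let ?C = "vproj H W V ` B"
  \<comment> \<open>Since the two projections are mutually inverse, the image is a preimage under a
    Borel map. This makes it Borel and identifies it with the set whose measure defines the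
    push-forward.\<close>
  have C: "?C = vproj H M V -` B \<inter> W"
  proof (intro equalityI subsetI)
    fix w assume "w \<in> ?C"
    then obtain m where m: "m \<in> B" "w = vproj H W V m" by blast
    thus "w \<in> vproj H M V -` B \<inter> W"
      using vproj_inverse[OF H M W a b, of m] vproj_mem[OF H W a] \<open>B \<subseteq> M\<close> by auto
  next
    fix w assume "w \<in> vproj H M V -` B \<inter> W"
    thus "w \<in> ?C"
      using vproj_inverse[OF H W M b a, of w] by (intro image_eqI[of _ _ "vproj H M V w"]) auto
  qed
  have C_borel [measurable]: "?C \<in> sets borel"
    using measurable_sets[OF P_M_meas \<open>B \<in> sets borel\<close>] unfolding C by simp
  have CW: "?C \<subseteq> W" unfolding C by blast

  have pushforward: "emeasure (distr (restrict_space (hausdorff q) W) (restrict_space borel M) (vproj H M V)) B =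
      emeasure (hausdorff q) ?C"
  proof -
    have "vproj H M V \<in> measurable (hausdorff q) borel"
      using P_M_meas by (simp cong: measurable_cong_sets)
    hence "vproj H M V \<in> measurable (restrict_space (hausdorff q) W) (restrict_space borel M)"
      using vproj_mem[OF H M b]
      by (intro measurable_restrict_space2 measurable_restrict_space1) (auto simp: space_restrict_space)
    moreover have "B \<in> sets (restrict_space borel M)"
      using \<open>B \<subseteq> M\<close> by (auto simp: sets_restrict_space_iff)
    ultimately have "emeasure (distr (restrict_space (hausdorff q) W) (restrict_space borel M) (vproj H M V)) B =
        emeasure (restrict_space (hausdorff q) W) ?C"
      by (simp add: emeasure_distr space_restrict_space C)
    also have "\<dots> = emeasure (hausdorff q) ?C"
      using CW by (intro emeasure_restrict_space) auto
    finally show ?thesis .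
  qed

  define D where "D xs = mv_list N e xs {1..N}" for xs
  obtain bs where bs: "set bs = (Basis :: 'a set)" "distinct bs"
    using finite_distinct_list[OF finite_Basis] by blast
  have len: "length bs = N"
    using distinct_card[OF bs(2)] bs(1) DIM by simp
  \<comment> \<open>The coefficient of the list of the e i is 1 and a multiple of
    \<open>D bs\<close>. The splitting is used with an empty first list. \<open>D bs\<close> later
    cancels from the quotient of the norms.\<close>
  have D_bs: "D bs \<noteq> 0"
  proof -
    let ?es = "map e [1..<Suc N]"
    have set_es: "set ?es = e ` {1..N}" by auto
    have inj: "inj_on e {1..N}"
    proof (rule inj_onI)
      fix i j assume ij: "i \<in> {1..N}" "j \<in> {1..N}" "e i = e j"
      thus "i = j"
        using e_inner[of i i] e_inner[of i j] by (simp split: if_splits)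
    qed
    have dist: "distinct ?es"
      using inj by (simp add: distinct_map atLeastLessThanSuc_atLeastAtMost del: upt_Suc)
    have orth: "orthonormal (set ?es)"
      unfolding set_es orthonormal_def
      by (auto simp: e_inner inj_on_eq_iff[OF inj] simp del: One_nat_def)
    have "independent (set ?es)"
      by (rule orthonormal_independent[OF orth])
    hence "dim (set ?es) = DIM('a)"
      using distinct_card[OF dist] by (simp add: dim_eq_card_independent DIM del: upt_Suc)
    hence "span (set ?es) = UNIV"
      by (simp only: dim_eq_full)
    hence "\<exists>d. D ([] @ ?es) = d * D bs"
      using emeasure_lborel_split_cube[OF bs, of "[]" ?es "\<lambda>_. 0" N e "{1..N}"] dist orth len
      by (auto simp: D_def orthonormal_def linear_zero simp del: upt_Suc)
    moreover have "D ?es = 1"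
      unfolding D_def using e_inner by (rule mv_list_basis)
    ultimately show ?thesis by auto
  qed

  let ?R = "unit_cube (set vs)"
  have R [measurable]: "?R \<in> sets borel"
    by (rule borel_closed[OF closed_unit_cube])
  \<comment> \<open>This is the identity H(A) |d| = \<kappa> L(A + Q) for one vertical subgroup S.
    It comes from \<open>hausdorff_slab\<close> for the complementary projection x - p x onto S, the
    slab over the unit cube of S having volume |d|.\<close>
  have vol: "\<exists>d. d \<noteq> 0 \<and> mv_norm N (mv_list N e vs \<and>\<^sub>m mv_list N e us) = \<bar>d\<bar> * \<bar>D bs\<bar> \<and>
      (\<forall>A\<in>sets borel. A \<subseteq> S \<longrightarrow> emeasure (hausdorff q) A * ennreal \<bar>d\<bar> =
        hausdorff_outer q (unit_cube (set us)) * emeasure lborel {y. y - p y \<in> A \<and> p y \<in> ?R})"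
    if us: "orthonormal (set us)" "distinct us" "span (set us) = S"
      and p: "linear p" "\<And>x. p x \<in> V" "\<And>x. x - p x \<in> S"
        "\<And>x. x \<in> V \<Longrightarrow> p x = x" "\<And>x. x \<in> S \<Longrightarrow> p x = 0"
      and card: "card (set us) = q" for us S p
  proof -
    have lus: "length vs + length us = length bs"
      using distinct_card[OF us(2)] card assms(9) k by (simp add: len N_def q_def)
    obtain d where d: "d \<noteq> 0" "D (vs @ us) = d * D bs"
      "emeasure lborel {y. y - p y \<in> unit_cube (set us) \<and> p y \<in> ?R} = ennreal \<bar>d\<bar>"
      using emeasure_lborel_split_cube[OF bs vs(1,2) us(1,2) lus, of p N e "{1..N}"] p
      unfolding D_def vs(3) us(3) by blast
    have "mv_norm N (mv_list N e vs \<and>\<^sub>m mv_list N e us) = \<bar>d\<bar> * \<bar>D bs\<bar>"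
      using mv_norm_top[of "vs @ us" N e] lus len d(2)
      by (simp add: mv_list_append[symmetric] D_def abs_mult)
    moreover have "emeasure (hausdorff q) A * ennreal \<bar>d\<bar> =
        hausdorff_outer q (unit_cube (set us)) * emeasure lborel {y. y - p y \<in> A \<and> p y \<in> ?R}"
      if A: "A \<in> sets borel" "A \<subseteq> S" for A
    proof -
      have "linear (\<lambda>x. x - p x)"
        using p(1) by (intro linear_compose_sub linear_ident)
      thus ?thesis
        using hausdorff_slab[of "set us" q "\<lambda>x. x - p x" A ?R] us card p A R d(3) by simp
    qed
    ultimately show ?thesis
      using d(1) by blast
  qed
  obtain dM where dM: "dM \<noteq> 0"
    "mv_norm N (mv_list N e vs \<and>\<^sub>m mv_list N e (ms @ [e (2 * n + 1)])) = \<bar>dM\<bar> * \<bar>D bs\<bar>"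
    "\<And>A. A \<in> sets borel \<Longrightarrow> A \<subseteq> M \<Longrightarrow> emeasure (hausdorff q) A * ennreal \<bar>dM\<bar> =
        hausdorff_outer q (unit_cube (set (ms @ [e (2 * n + 1)]))) *
          emeasure lborel {y. y - b y \<in> A \<and> b y \<in> ?R}"
    using vol[OF ms b card(2)] by blast
  obtain dW where dW: "dW \<noteq> 0"
    "mv_norm N (mv_list N e vs \<and>\<^sub>m mv_list N e (ws @ [e (2 * n + 1)])) = \<bar>dW\<bar> * \<bar>D bs\<bar>"
    "\<And>A. A \<in> sets borel \<Longrightarrow> A \<subseteq> W \<Longrightarrow> emeasure (hausdorff q) A * ennreal \<bar>dW\<bar> =
        hausdorff_outer q (unit_cube (set (ws @ [e (2 * n + 1)]))) *
          emeasure lborel {y. y - a y \<in> A \<and> a y \<in> ?R}"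
    using vol[OF ws a card(1)] by blast
  have "emeasure lborel {y. y - a y \<in> ?C \<and> a y \<in> ?R} = emeasure lborel {y. y - b y \<in> B \<and> b y \<in> ?R}"
    by (rule emeasure_lborel_vproj_slab[OF H M W a b norm \<open>B \<subseteq> M\<close> C_borel R])
  \<comment> \<open>The shear makes the volumes of the two slabs equal, and both identities contain
    the same \<kappa>.\<close>
  hence "emeasure (hausdorff q) ?C * ennreal \<bar>dW\<bar> = emeasure (hausdorff q) B * ennreal \<bar>dM\<bar>"
    unfolding dW(3)[OF C_borel CW] dM(3)[OF \<open>B \<in> sets borel\<close> \<open>B \<subseteq> M\<close>]
    using hausdorff_outer_unit_cube_eq[OF ws(1) ms(1)] card by simp
  \<comment> \<open>Multiplication by the finite factor 1 / |dW| is also valid when the measures are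
    infinite.\<close>
  hence "emeasure (hausdorff q) ?C * (ennreal \<bar>dW\<bar> * ennreal (1 / \<bar>dW\<bar>)) =
      emeasure (hausdorff q) B * (ennreal \<bar>dM\<bar> * ennreal (1 / \<bar>dW\<bar>))"
    by (simp add: mult.assoc[symmetric])
  also have "ennreal \<bar>dW\<bar> * ennreal (1 / \<bar>dW\<bar>) = 1"
    using dW(1) by (simp add: ennreal_mult[symmetric])
  also have "ennreal \<bar>dM\<bar> * ennreal (1 / \<bar>dW\<bar>) = ennreal (\<bar>dM\<bar> * \<bar>D bs\<bar> / (\<bar>dW\<bar> * \<bar>D bs\<bar>))"
    using D_bs by (simp add: ennreal_mult[symmetric])
  finally have "emeasure (hausdorff q) ?C =
      ennreal (\<bar>dM\<bar> * \<bar>D bs\<bar> / (\<bar>dW\<bar> * \<bar>D bs\<bar>)) * emeasure (hausdorff q) B"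
    by (simp add: mult.commute)
  thus ?thesis
    using pushforward dM(2) dW(2) by (simp add: q_def N_def)
qed

end
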